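(* Let $\mathcal{C}$ be a triangulated category. The following conditions on a couple $(C_1,C_2)$ of subclasses of $\mathrm{Obj}\,\mathcal{C}$ are equivalent. 1. The full subcategories of $\mathcal{C}$ corresponding to $C_2$ and $C_1$ (in this order) give a semi-orthogonal decomposition of $\mathcal{C}$. 2. $(C_2,C_1)$ is a $t$-structure and $C_1[1]=C_1$. 3. The full subcategory $\mathcal{C}_1$ of $\mathcal{C}$ corresponding to $C_1$ is strict, triangulated, and right admissible (that is, there exists a right adjoint to the embedding $\mathcal{C}_1\to\mathcal{C}$), and $C_2=C_1^\perp$. 4. $(C_1,C_2)$ is a weight structure and $C_1[1]=C_1$. 5. $(C_1,C_2)$ is a weight structure, $C_1[1]=C_1$, and $C_2[1]=C_2$. 6. $(C_1,C_2)$ is a weight structure $w$ and $\underline{Hw}=\{0\}$. 7. $(C_1,C_2)$ is a weight structure $w$ and the weight decomposition triangle $L_wM\to M\to R_wM\to L_wM[1]$ is functorially determined by $M\in\mathrm{Obj}\,\mathcal{C}$. 8. $(C_1,C_2)$ is a weight structure $w$ and the weight decomposition triangle $L_wM\to M\to R_wM\to L_wM[1]$ is determined by $M\in\mathrm{Obj}\,\mathcal{C}$ up to a non-canonical isomorphism.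
   Context: Conventions: $X\perp Y$ means $\mathcal{C}(X,Y)=0$; for classes $D\perp E$ means $X\perp Y$ for all $X\in D$, $Y\in E$; $D^\perp=\{Y:\ X\perp Y\ \forall X\in D\}$; $D\star E$ is the class of all $C$ fitting into a distinguished triangle $A\to C\to B\to A[1]$ with $A\in D$, $B\in E$. A couple $(\mathcal{A},\mathcal{B})$ of strictly full triangulated subcategories of $\mathcal{C}$ is a semi-orthogonal decomposition of $\mathcal{C}$ if $\mathrm{Obj}\,\mathcal{B}\perp\mathrm{Obj}\,\mathcal{A}$ and $\mathrm{Obj}\,\mathcal{B}\star\mathrm{Obj}\,\mathcal{A}=\mathrm{Obj}\,\mathcal{C}$. A $t$-structure is a couple $(\mathcal{C}_{t\le 0},\mathcal{C}_{t\ge 0})$ (in this order; homological convention) of classes of objects closed under isomorphism such that $\mathcal{C}_{t\le 0}\subset \mathcal{C}_{t\le 0}[1]$, $\mathcal{C}_{t\ge 0}[1]\subset \mathcal{C}_{t\ge 0}$, $\mathcal{C}_{t\ge 0}[1]\perp \mathcal{C}_{t\le 0}$, and every object $M$ fits into a distinguished triangle $L_tM\to M\to R_tM\to L_tM[1]$ with $L_tM\in \mathcal{C}_{t\ge 0}$, $R_tM\in\mathcal{C}_{t\le 0}[-1]$. A weight structure is a couple $(\mathcal{C}_{w\le 0},\mathcal{C}_{w\ge 0})$ (in this order) of classes of objects closed under retracts such that $\mathcal{C}_{w\le 0}\subset \mathcal{C}_{w\le 0}[1]$, $\mathcal{C}_{w\ge 0}[1]\subset \mathcal{C}_{w\ge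 0}$, $\mathcal{C}_{w\le 0}\perp \mathcal{C}_{w\ge 0}[1]$, and every object $M$ possesses a weight decomposition, i.e. a distinguished triangle $L_wM\to M\to R_wM\to L_wM[1]$ with $L_wM\in \mathcal{C}_{w\le 0}$, $R_wM\in\mathcal{C}_{w\ge 0}[1]$. The heart $\underline{Hw}$ is the full subcategory with objects $\mathcal{C}_{w\le 0}\cap \mathcal{C}_{w\ge 0}$. *)

theory Defs
  imports "HOL-Algebra.Group"
begin

text \<open>
  A category is given by a set of objects and a set of morphisms; each morphism carries its source
  and target. Composition is in the usual order, i.e. \<open>g \<cdot> f\<close> is \<open>f\<close> followed by \<open>g\<close>. A class of
  objects is a subset of \<open>Obj C\<close>.
\<close>

record ('o, 'm) precat =
  Obj :: "'o set"
  Mor :: "'m set"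
  Src :: "'m \<Rightarrow> 'o"
  Tgt :: "'m \<Rightarrow> 'o"
  Ident :: "'o \<Rightarrow> 'm"
  Comp :: "'m \<Rightarrow> 'm \<Rightarrow> 'm" (infixl "\<cdot>\<index>" 70)

definition Hom :: "('o, 'm, 'z) precat_scheme \<Rightarrow> 'o \<Rightarrow> 'o \<Rightarrow> 'm set" where
  "Hom C X Y = {f \<in> Mor C. Src C f = X \<and> Tgt C f = Y}"

locale category =
  fixes C :: "('o, 'm, 'z) precat_scheme" (structure)
  assumes src_closed: "f \<in> Mor C \<Longrightarrow> Src C f \<in> Obj C"
    and tgt_closed: "f \<in> Mor C \<Longrightarrow> Tgt C f \<in> Obj C"
    and ident_closed: "X \<in> Obj C \<Longrightarrow> Ident C X \<in> Hom C X X"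
    and comp_closed: "\<lbrakk>f \<in> Hom C X Y; g \<in> Hom C Y Z\<rbrakk> \<Longrightarrow> g \<cdot> f \<in> Hom C X Z"
    and comp_assoc: "\<lbrakk>f \<in> Hom C W X; g \<in> Hom C X Y; h \<in> Hom C Y Z\<rbrakk> \<Longrightarrow> h \<cdot> g \<cdot> f = h \<cdot> (g \<cdot> f)"
    and comp_ident: "f \<in> Hom C X Y \<Longrightarrow> f \<cdot> Ident C X = f"
    and ident_comp: "f \<in> Hom C X Y \<Longrightarrow> Ident C Y \<cdot> f = f"

definition iso_mor :: "('o, 'm, 'z) precat_scheme \<Rightarrow> 'o \<Rightarrow> 'o \<Rightarrow> 'm \<Rightarrow> bool" where
  "iso_mor C X Y f \<longleftrightarrow> f \<in> Hom C X Y \<and>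
     (\<exists>g \<in> Hom C Y X. g \<cdot>\<^bsub>C\<^esub> f = Ident C X \<and> f \<cdot>\<^bsub>C\<^esub> g = Ident C Y)"

definition isomorphic :: "('o, 'm, 'z) precat_scheme \<Rightarrow> 'o \<Rightarrow> 'o \<Rightarrow> bool" where
  "isomorphic C X Y \<longleftrightarrow> (\<exists>f. iso_mor C X Y f)"

definition retract_of :: "('o, 'm, 'z) precat_scheme \<Rightarrow> 'o \<Rightarrow> 'o \<Rightarrow> bool" where
  "retract_of C X Y \<longleftrightarrow>
     X \<in> Obj C \<and> (\<exists>i \<in> Hom C X Y. \<exists>p \<in> Hom C Y X. p \<cdot>\<^bsub>C\<^esub> i = Ident C X)"

definition iso_closed :: "('o, 'm, 'z) precat_scheme \<Rightarrow> 'o set \<Rightarrow> bool" where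
  "iso_closed C D \<longleftrightarrow> (\<forall>X \<in> D. \<forall>Y \<in> Obj C. isomorphic C X Y \<longrightarrow> Y \<in> D)"

definition retract_closed :: "('o, 'm, 'z) precat_scheme \<Rightarrow> 'o set \<Rightarrow> bool" where
  "retract_closed C D \<longleftrightarrow> (\<forall>Y \<in> D. \<forall>X \<in> Obj C. retract_of C X Y \<longrightarrow> X \<in> D)"

definition zero_object :: "('o, 'm, 'z) precat_scheme \<Rightarrow> 'o \<Rightarrow> bool" where
  "zero_object C Z \<longleftrightarrow>
     Z \<in> Obj C \<and> (\<forall>X \<in> Obj C. (\<exists>!f. f \<in> Hom C X Z) \<and> (\<exists>!f. f \<in> Hom C Z X))"

definition full_subcat :: "('o, 'm, 'z) precat_scheme \<Rightarrow> 'o set \<Rightarrow> ('o, 'm) precat" where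
  "full_subcat C D = \<lparr>Obj = D, Mor = {f \<in> Mor C. Src C f \<in> D \<and> Tgt C f \<in> D},
     Src = Src C, Tgt = Tgt C, Ident = Ident C, Comp = Comp C\<rparr>"

definition cat_functor ::
  "('o, 'm, 'z) precat_scheme \<Rightarrow> ('p, 'n, 'y) precat_scheme \<Rightarrow> ('o \<Rightarrow> 'p) \<Rightarrow> ('m \<Rightarrow> 'n) \<Rightarrow> bool" where
  "cat_functor C D Fo Fm \<longleftrightarrow>
     (\<forall>X \<in> Obj C. Fo X \<in> Obj D) \<and>
     (\<forall>f \<in> Mor C. Fm f \<in> Hom D (Fo (Src C f)) (Fo (Tgt C f))) \<and>
     (\<forall>X \<in> Obj C. Fm (Ident C X) = Ident D (Fo X)) \<and>
     (\<forall>f \<in> Mor C. \<forall>g \<in> Mor C. Src C g = Tgt C f \<longrightarrow> Fm (g \<cdot>\<^bsub>C\<^esub> f) = Fm g \<cdot>\<^bsub>D\<^esub> Fm f)"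

text \<open>\<open>G : D \<rightarrow> C\<close> is right adjoint to \<open>F : C \<rightarrow> D\<close>.\<close>

definition right_adjoint_to ::
  "('o, 'm, 'z) precat_scheme \<Rightarrow> ('p, 'n, 'y) precat_scheme \<Rightarrow>
   ('o \<Rightarrow> 'p) \<Rightarrow> ('m \<Rightarrow> 'n) \<Rightarrow> ('p \<Rightarrow> 'o) \<Rightarrow> ('n \<Rightarrow> 'm) \<Rightarrow> bool" where
  "right_adjoint_to C D Fo Fm Go Gm \<longleftrightarrow>
     cat_functor C D Fo Fm \<and> cat_functor D C Go Gm \<and>
     (\<exists>\<Phi>. (\<forall>X \<in> Obj C. \<forall>Y \<in> Obj D. bij_betw (\<Phi> X Y) (Hom D (Fo X) Y) (Hom C X (Go Y))) \<and>
          (\<forall>X \<in> Obj C. \<forall>X' \<in> Obj C. \<forall>Y \<in> Obj D. \<forall>Y' \<in> Obj D.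
             \<forall>u \<in> Hom C X' X. \<forall>v \<in> Hom D Y Y'. \<forall>f \<in> Hom D (Fo X) Y.
               \<Phi> X' Y' (v \<cdot>\<^bsub>D\<^esub> f \<cdot>\<^bsub>D\<^esub> Fm u) = Gm v \<cdot>\<^bsub>C\<^esub> \<Phi> X Y f \<cdot>\<^bsub>C\<^esub> u))"

definition right_admissible :: "('o, 'm, 'z) precat_scheme \<Rightarrow> 'o set \<Rightarrow> bool" where
  "right_admissible C D \<longleftrightarrow> (\<exists>Go Gm. right_adjoint_to (full_subcat C D) C id id Go Gm)"

record ('o, 'm) addcat = "('o, 'm) precat" +
  Add :: "'m \<Rightarrow> 'm \<Rightarrow> 'm" (infixl "\<oplus>\<index>" 65)
  Zero :: "'o \<Rightarrow> 'o \<Rightarrow> 'm"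

definition hom_group :: "('o, 'm, 'z) addcat_scheme \<Rightarrow> 'o \<Rightarrow> 'o \<Rightarrow> 'm monoid" where
  "hom_group C X Y = \<lparr>carrier = Hom C X Y, mult = Add C, one = Zero C X Y\<rparr>"

definition Neg :: "('o, 'm, 'z) addcat_scheme \<Rightarrow> 'm \<Rightarrow> 'm" where
  "Neg C f = inv\<^bsub>hom_group C (Src C f) (Tgt C f)\<^esub> f"

locale additive_category = category C for C :: "('o, 'm, 'z) addcat_scheme" (structure) +
  assumes hom_comm_group: "\<lbrakk>X \<in> Obj C; Y \<in> Obj C\<rbrakk> \<Longrightarrow> comm_group (hom_group C X Y)"
    and comp_add_right: "\<lbrakk>f \<in> Hom C X Y; f' \<in> Hom C X Y; g \<in> Hom C Y Z\<rbrakk>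
           \<Longrightarrow> g \<cdot> (f \<oplus> f') = (g \<cdot> f) \<oplus> (g \<cdot> f')"
    and comp_add_left: "\<lbrakk>f \<in> Hom C X Y; g \<in> Hom C Y Z; g' \<in> Hom C Y Z\<rbrakk>
           \<Longrightarrow> (g \<oplus> g') \<cdot> f = (g \<cdot> f) \<oplus> (g' \<cdot> f)"
    and ex_zero_object: "\<exists>Z. zero_object C Z"
    and ex_biproduct: "\<lbrakk>X \<in> Obj C; Y \<in> Obj C\<rbrakk> \<Longrightarrow>
           \<exists>P \<in> Obj C. \<exists>i \<in> Hom C X P. \<exists>j \<in> Hom C Y P. \<exists>p \<in> Hom C P X. \<exists>q \<in> Hom C P Y.
             p \<cdot> i = Ident C X \<and> q \<cdot> j = Ident C Y \<and> p \<cdot> j = Zero C Y X \<and> q \<cdot> i = Zero C X Y \<and>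
             (i \<cdot> p) \<oplus> (j \<cdot> q) = Ident C P"

text \<open>
  A triple \<open>(f, g, h)\<close> stands for a triangle \<open>X \<rightarrow> Y \<rightarrow> Z \<rightarrow> X[1]\<close>; its vertices are recovered as
  sources and targets. \<open>ShO\<close> and \<open>ShM\<close> are the action of the shift \<open>[1]\<close> on objects and morphisms.
\<close>

type_synonym 'm triangle = "'m \<times> 'm \<times> 'm"

record ('o, 'm) tricat = "('o, 'm) addcat" +
  ShO :: "'o \<Rightarrow> 'o"
  ShM :: "'m \<Rightarrow> 'm"
  Dist :: "'m triangle set"

fun fst_vertex :: "('o, 'm, 'z) tricat_scheme \<Rightarrow> 'm triangle \<Rightarrow> 'o" where
  "fst_vertex C (f, g, h) = Src C f"

fun mid_vertex :: "('o, 'm, 'z) tricat_scheme \<Rightarrow> 'm triangle \<Rightarrow> 'o" where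
  "mid_vertex C (f, g, h) = Src C g"

fun trd_vertex :: "('o, 'm, 'z) tricat_scheme \<Rightarrow> 'm triangle \<Rightarrow> 'o" where
  "trd_vertex C (f, g, h) = Src C h"

text \<open>Candidate triangles; no condition on the composites is imposed.\<close>

definition triangles :: "('o, 'm, 'z) tricat_scheme \<Rightarrow> 'm triangle set" where
  "triangles C = {(f, g, h). f \<in> Mor C \<and> g \<in> Mor C \<and> h \<in> Mor C \<and>
     Tgt C f = Src C g \<and> Tgt C g = Src C h \<and> Tgt C h = ShO C (Src C f)}"

definition triangle_mor ::
  "('o, 'm, 'z) tricat_scheme \<Rightarrow> 'm triangle \<Rightarrow> 'm triangle \<Rightarrow> 'm \<times> 'm \<times> 'm \<Rightarrow> bool" where
  "triangle_mor C T T' \<phi> \<longleftrightarrow>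
     (case (T, T', \<phi>) of ((f, g, h), (f', g', h'), (a, b, c)) \<Rightarrow>
        a \<in> Hom C (Src C f) (Src C f') \<and> b \<in> Hom C (Src C g) (Src C g') \<and>
        c \<in> Hom C (Src C h) (Src C h') \<and>
        b \<cdot>\<^bsub>C\<^esub> f = f' \<cdot>\<^bsub>C\<^esub> a \<and> c \<cdot>\<^bsub>C\<^esub> g = g' \<cdot>\<^bsub>C\<^esub> b \<and> ShM C a \<cdot>\<^bsub>C\<^esub> h = h' \<cdot>\<^bsub>C\<^esub> c)"

text \<open>
  The category of candidate triangles. A morphism of triangles is recorded together with its source
  and its target, as \<open>(T, (a, b, c), T')\<close>.
\<close>

type_synonym 'm triangle_arrow = "'m triangle \<times> ('m \<times> 'm \<times> 'm) \<times> 'm triangle"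

definition triangle_cat ::
  "('o, 'm, 'z) tricat_scheme \<Rightarrow> ('m triangle, 'm triangle_arrow) precat" where
  "triangle_cat C =
     \<lparr>Obj = triangles C,
      Mor = {(T, \<phi>, T'). T \<in> triangles C \<and> T' \<in> triangles C \<and> triangle_mor C T T' \<phi>},
      Src = (\<lambda>(T, \<phi>, T'). T),
      Tgt = (\<lambda>(T, \<phi>, T'). T'),
      Ident = (\<lambda>T. (T, (Ident C (fst_vertex C T), Ident C (mid_vertex C T), Ident C (trd_vertex C T)), T)),
      Comp = (\<lambda>(_, (a', b', c'), T'') (T, (a, b, c), _).
                (T, (a' \<cdot>\<^bsub>C\<^esub> a, b' \<cdot>\<^bsub>C\<^esub> b, c' \<cdot>\<^bsub>C\<^esub> c), T''))\<rparr>"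

fun mid_component :: "'m triangle_arrow \<Rightarrow> 'm" where
  "mid_component (T, (a, b, c), T') = b"

text \<open>
  The shift is an automorphism of the category (not merely an autoequivalence). The last
  axiom is the octahedral axiom: \<open>(u, v, f'[1] \<cdot> g'')\<close> is a triangle on the cones of \<open>f\<close>,
  \<open>g \<cdot> f\<close> and \<open>g\<close>.
\<close>

locale triangulated_category = additive_category C for C :: "('o, 'm, 'z) tricat_scheme" (structure) +
  assumes shift_functor: "cat_functor C C (ShO C) (ShM C)"
    and shift_bij_obj: "bij_betw (ShO C) (Obj C) (Obj C)"
    and shift_bij_mor: "bij_betw (ShM C) (Mor C) (Mor C)"
    and shift_additive: "\<lbrakk>X \<in> Obj C; Y \<in> Obj C\<rbrakk>
           \<Longrightarrow> ShM C \<in> hom (hom_group C X Y) (hom_group C (ShO C X) (ShO C Y))"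
    and dist_triangles: "Dist C \<subseteq> triangles C"
    and dist_iso: "\<lbrakk>T \<in> Dist C; isomorphic (triangle_cat C) T T'\<rbrakk> \<Longrightarrow> T' \<in> Dist C"
    and dist_ident: "\<lbrakk>X \<in> Obj C; zero_object C Z\<rbrakk>
           \<Longrightarrow> (Ident C X, Zero C X Z, Zero C Z (ShO C X)) \<in> Dist C"
    and dist_cone: "f \<in> Mor C \<Longrightarrow> \<exists>g h. (f, g, h) \<in> Dist C"
    and dist_rotate: "(f, g, h) \<in> triangles C
           \<Longrightarrow> (f, g, h) \<in> Dist C \<longleftrightarrow> (g, h, Neg C (ShM C f)) \<in> Dist C"
    and dist_morphism: "\<lbrakk>(f, g, h) \<in> Dist C; (f', g', h') \<in> Dist C;
             a \<in> Hom C (Src C f) (Src C f'); b \<in> Hom C (Tgt C f) (Tgt C f'); b \<cdot> f = f' \<cdot> a\<rbrakk>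
           \<Longrightarrow> \<exists>c. triangle_mor C (f, g, h) (f', g', h') (a, b, c)"
    and octahedral: "\<lbrakk>f \<in> Hom C X Y; g \<in> Hom C Y Z;
             (f, f', f'') \<in> Dist C; (g, g', g'') \<in> Dist C; (g \<cdot> f, h', h'') \<in> Dist C\<rbrakk>
           \<Longrightarrow> \<exists>u v. (u, v, ShM C f' \<cdot> g'') \<in> Dist C \<and>
                 triangle_mor C (f, f', f'') (g \<cdot> f, h', h'') (Ident C X, g, u) \<and>
                 triangle_mor C (g \<cdot> f, h', h'') (g, g', g'') (f, Ident C Z, v)"

definition shift_class :: "('o, 'm, 'z) tricat_scheme \<Rightarrow> 'o set \<Rightarrow> 'o set" where
  "shift_class C D = ShO C ` D"

definition unshift_class :: "('o, 'm, 'z) tricat_scheme \<Rightarrow> 'o set \<Rightarrow> 'o set" where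
  "unshift_class C D = {X \<in> Obj C. ShO C X \<in> D}"

definition orthogonal :: "('o, 'm, 'z) addcat_scheme \<Rightarrow> 'o set \<Rightarrow> 'o set \<Rightarrow> bool" where
  "orthogonal C D E \<longleftrightarrow> (\<forall>X \<in> D. \<forall>Y \<in> E. Hom C X Y = {Zero C X Y})"

definition right_orthogonal :: "('o, 'm, 'z) addcat_scheme \<Rightarrow> 'o set \<Rightarrow> 'o set" where
  "right_orthogonal C D = {Y \<in> Obj C. \<forall>X \<in> D. Hom C X Y = {Zero C X Y}}"

definition star :: "('o, 'm, 'z) tricat_scheme \<Rightarrow> 'o set \<Rightarrow> 'o set \<Rightarrow> 'o set" where
  "star C D E =
     {M. \<exists>T \<in> Dist C. fst_vertex C T \<in> D \<and> mid_vertex C T = M \<and> trd_vertex C T \<in> E}"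

text \<open>
  The full subcategory on \<open>D\<close> is triangulated. Closure under biproducts follows from the cone
  condition, as \<open>X \<oplus> Y\<close> is a cone of the zero morphism \<open>Y[-1] \<rightarrow> X\<close>.
\<close>

definition triangulated_subcat :: "('o, 'm, 'z) tricat_scheme \<Rightarrow> 'o set \<Rightarrow> bool" where
  "triangulated_subcat C D \<longleftrightarrow>
     D \<subseteq> Obj C \<and> (\<exists>Z \<in> D. zero_object C Z) \<and> shift_class C D = D \<and>
     (\<forall>X \<in> D. \<forall>Y \<in> D. \<forall>f \<in> Hom C X Y. \<exists>g h. (f, g, h) \<in> Dist C \<and> Tgt C g \<in> D)"

definition semiorthogonal_decomposition ::
  "('o, 'm, 'z) tricat_scheme \<Rightarrow> 'o set \<Rightarrow> 'o set \<Rightarrow> bool" where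
  "semiorthogonal_decomposition C A B \<longleftrightarrow>
     iso_closed C A \<and> triangulated_subcat C A \<and>
     iso_closed C B \<and> triangulated_subcat C B \<and>
     orthogonal C B A \<and> star C B A = Obj C"

text \<open>
  The arguments are \<open>C\<^bsub>t\<le>0\<^esub>\<close> and \<open>C\<^bsub>t\<ge>0\<^esub>\<close>, respectively \<open>C\<^bsub>w\<le>0\<^esub>\<close> and \<open>C\<^bsub>w\<ge>0\<^esub>\<close>, in this order;
  the convention is homological.
\<close>

definition t_structure :: "('o, 'm, 'z) tricat_scheme \<Rightarrow> 'o set \<Rightarrow> 'o set \<Rightarrow> bool" where
  "t_structure C Tle Tge \<longleftrightarrow>
     Tle \<subseteq> Obj C \<and> Tge \<subseteq> Obj C \<and> iso_closed C Tle \<and> iso_closed C Tge \<and>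
     Tle \<subseteq> shift_class C Tle \<and> shift_class C Tge \<subseteq> Tge \<and>
     orthogonal C (shift_class C Tge) Tle \<and>
     (\<forall>M \<in> Obj C. \<exists>T \<in> Dist C. mid_vertex C T = M \<and>
        fst_vertex C T \<in> Tge \<and> trd_vertex C T \<in> unshift_class C Tle)"

definition weight_decomposition ::
  "('o, 'm, 'z) tricat_scheme \<Rightarrow> 'o set \<Rightarrow> 'o set \<Rightarrow> 'o \<Rightarrow> 'm triangle \<Rightarrow> bool" where
  "weight_decomposition C Wle Wge M T \<longleftrightarrow>
     T \<in> Dist C \<and> mid_vertex C T = M \<and>
     fst_vertex C T \<in> Wle \<and> trd_vertex C T \<in> shift_class C Wge"

definition weight_structure :: "('o, 'm, 'z) tricat_scheme \<Rightarrow> 'o set \<Rightarrow> 'o set \<Rightarrow> bool" where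
  "weight_structure C Wle Wge \<longleftrightarrow>
     Wle \<subseteq> Obj C \<and> Wge \<subseteq> Obj C \<and> retract_closed C Wle \<and> retract_closed C Wge \<and>
     Wle \<subseteq> shift_class C Wle \<and> shift_class C Wge \<subseteq> Wge \<and>
     orthogonal C Wle (shift_class C Wge) \<and>
     (\<forall>M \<in> Obj C. \<exists>T. weight_decomposition C Wle Wge M T)"

definition weight_heart :: "'o set \<Rightarrow> 'o set \<Rightarrow> 'o set" where
  "weight_heart Wle Wge = Wle \<inter> Wge"

text \<open>
  The weight decomposition is functorially determined by \<open>M\<close>: there is a functor \<open>W\<close> to triangles
  such that \<open>W(M)\<close> is a weight decomposition of \<open>M\<close>, the middle component of \<open>W(u)\<close> is \<open>u\<close>, and every weight decomposition of \<open>M\<close> is canonically isomorphic to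
  \<open>W(M)\<close>, i.e. by a unique isomorphism that is the identity on \<open>M\<close>. The mere existence of \<open>W\<close> would
  not express that the triangle is determined by \<open>M\<close>.
\<close>

definition functorially_determined_decompositions ::
  "('o, 'm, 'z) tricat_scheme \<Rightarrow> 'o set \<Rightarrow> 'o set \<Rightarrow> bool" where
  "functorially_determined_decompositions C Wle Wge \<longleftrightarrow>
     (\<exists>Wo Wm. cat_functor C (triangle_cat C) Wo Wm \<and>
        (\<forall>M \<in> Obj C. weight_decomposition C Wle Wge M (Wo M)) \<and>
        (\<forall>u \<in> Mor C. mid_component (Wm u) = u) \<and>
        (\<forall>M \<in> Obj C. \<forall>T. weight_decomposition C Wle Wge M T \<longrightarrow>
           (\<exists>!\<phi>. iso_mor (triangle_cat C) T (Wo M) \<phi> \<and> mid_component \<phi> = Ident C M)))"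

definition decompositions_determined_up_to_iso ::
  "('o, 'm, 'z) tricat_scheme \<Rightarrow> 'o set \<Rightarrow> 'o set \<Rightarrow> bool" where
  "decompositions_determined_up_to_iso C Wle Wge \<longleftrightarrow>
     (\<forall>M \<in> Obj C. \<forall>T T'. weight_decomposition C Wle Wge M T \<longrightarrow>
        weight_decomposition C Wle Wge M T' \<longrightarrow> isomorphic (triangle_cat C) T T')"

end

theory Submission
  imports Defs
begin

text \<open>
  All eight conditions are compared with one weak form of the first: \<open>C1\<close> and \<open>C2\<close> are closed
  under isomorphism, \<open>C1[1] = C1\<close>, \<open>C1 \<bottom> C2\<close>, and every object \<open>M\<close> lies in a distinguished
  triangle \<open>A \<rightarrow> M \<rightarrow> B \<rightarrow> A[1]\<close> with \<open>A \<in> C1\<close> and \<open>B \<in> C2\<close>. This is the locale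
  \<open>stable_decomposition\<close>.

  The weak form implies everything else because shift stability of \<open>C1\<close> makes also \<open>A[1]\<close>
  orthogonal to \<open>B\<close>. If \<open>C1 \<bottom> M\<close>, then \<open>A \<rightarrow> M\<close> vanishes, so the identity of \<open>A[1]\<close> factors
  through a morphism \<open>A[1] \<rightarrow> B\<close>, hence \<open>A = 0\<close> and \<open>M \<cong> B\<close>. Thus \<open>C2\<close> is the right orthogonal of
  \<open>C1\<close>, and dually \<open>C1\<close> is the left orthogonal of \<open>C2\<close>. Orthogonals are closed under retracts
  and extensions, so both classes are triangulated, and the \<open>t\<close>-structure and weight structure
  axioms follow. The vanishing of morphisms from \<open>C1\<close> to \<open>B\<close> and to \<open>B[-1]\<close> makes \<open>A \<rightarrow> M\<close> a
  coreflection of \<open>M\<close> in \<open>C1\<close>; together with the vanishing of morphisms from \<open>A[1]\<close> to \<open>C2\<close>, it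
  makes every morphism \<open>M \<rightarrow> M'\<close> extend uniquely to the decomposing triangles
  (\<open>decomposition_morphism\<close>), which gives functoriality and uniqueness.

  Conversely, a \<open>t\<close>-structure or a weight structure with \<open>C1[1] = C1\<close> satisfies the weak form
  after a shift. A coreflection \<open>A \<rightarrow> M\<close> in a triangulated subcategory has its cone in the right
  orthogonal. For the remaining three conditions it suffices that a weight structure with zero
  heart has \<open>C1[1] = C1\<close> (\<open>shift_stable_if_heart_zero\<close>): for \<open>M \<in> C1\<close> and a weight decomposition
  \<open>A \<rightarrow> M[1] \<rightarrow> B'[1]\<close>, the object \<open>B'\<close> is an extension of \<open>A\<close> by \<open>M\<close>, hence lies in the heart and
  vanishes, so \<open>M[1] \<cong> A\<close>. If weight decompositions are unique up to isomorphism, the heart is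
  zero, since for \<open>X\<close> in the heart both \<open>X \<rightarrow> 0 \<rightarrow> X[1]\<close> and \<open>0 \<rightarrow> 0 \<rightarrow> 0\<close> are weight decompositions
  of \<open>0\<close>.
\<close>

section \<open>Categories and additive categories\<close>

context category
begin

lemma hom_objD:
  assumes "f \<in> Hom C X Y"
  shows "X \<in> Obj C" "Y \<in> Obj C"
  using assms src_closed tgt_closed unfolding Hom_def by auto

lemma isomorphic_if_mutually_inverse:
  assumes "f \<in> Hom C X Y" "l \<in> Hom C Y X" "r \<in> Hom C Y X"
    and "l \<cdot> f = Ident C X" "f \<cdot> r = Ident C Y"
  shows "isomorphic C X Y"
proof -
  have "l = l \<cdot> (f \<cdot> r)"
    using assms comp_ident by simp
  also have "\<dots> = r"
    using assms comp_assoc[OF assms(3,1,2)] ident_comp by simp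
  finally show ?thesis
    using assms unfolding isomorphic_def iso_mor_def by blast
qed

lemma isomorphic_sym: "isomorphic C X Y \<Longrightarrow> isomorphic C Y X"
  unfolding isomorphic_def iso_mor_def by blast

lemma isomorphic_trans:
  assumes "isomorphic C X Y" "isomorphic C Y Z"
  shows "isomorphic C X Z"
proof -
  obtain f f' where f: "f \<in> Hom C X Y" "f' \<in> Hom C Y X" "f' \<cdot> f = Ident C X" "f \<cdot> f' = Ident C Y"
    using assms(1) unfolding isomorphic_def iso_mor_def by blast
  obtain g g' where g: "g \<in> Hom C Y Z" "g' \<in> Hom C Z Y" "g' \<cdot> g = Ident C Y" "g \<cdot> g' = Ident C Z"
    using assms(2) unfolding isomorphic_def iso_mor_def by blast
  have cancel: "b \<cdot> b' \<cdot> (a' \<cdot> a) = Ident C V"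
    if "a \<in> Hom C V W" "a' \<in> Hom C W U" "b' \<in> Hom C U W" "b \<in> Hom C W V"
      "b \<cdot> a = Ident C V" "b' \<cdot> a' = Ident C W" for a a' b b' U V W
    using comp_assoc[OF comp_closed[OF that(1,2)] that(3,4)] comp_assoc[OF that(1,2,3)] that(5,6)
      ident_comp[OF that(1)] by simp
  show ?thesis
    using cancel[OF f(1) g(1,2) f(2,3) g(3)] cancel[OF g(2) f(2,1) g(1,4) f(4)]
      comp_closed[OF f(1) g(1)] comp_closed[OF g(2) f(2)]
    unfolding isomorphic_def iso_mor_def by blast
qed

lemma isomorphic_imp_retract_of:
  assumes "isomorphic C X Y"
  shows "retract_of C Y X"
  using assms hom_objD unfolding isomorphic_def iso_mor_def retract_of_def by blast

lemma retract_closed_imp_iso_closed: "retract_closed C D \<Longrightarrow> iso_closed C D"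
  using isomorphic_imp_retract_of unfolding retract_closed_def iso_closed_def by blast

end

context additive_category
begin

lemma zero_closed: "\<lbrakk>X \<in> Obj C; Y \<in> Obj C\<rbrakk> \<Longrightarrow> Zero C X Y \<in> Hom C X Y"
  using comm_group.axioms(2)[OF hom_comm_group, THEN group.is_monoid, THEN monoid.one_closed]
  by (simp add: hom_group_def)

lemma neg_eq_inv: "f \<in> Hom C X Y \<Longrightarrow> Neg C f = inv\<^bsub>hom_group C X Y\<^esub> f"
  by (simp add: Neg_def Hom_def)

lemma neg_unique:
  assumes "f \<in> Hom C X Y" "g \<in> Hom C X Y" "g \<oplus> f = Zero C X Y"
  shows "Neg C f = g"
proof -
  interpret comm_group "hom_group C X Y"
    using hom_comm_group hom_objD[OF assms(1)] by blast
  show ?thesis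
    using inv_equality[of g f] assms neg_eq_inv[OF assms(1)] by (simp add: hom_group_def)
qed

lemma neg_closed: "f \<in> Hom C X Y \<Longrightarrow> Neg C f \<in> Hom C X Y"
  and neg_add: "f \<in> Hom C X Y \<Longrightarrow> Neg C f \<oplus> f = Zero C X Y"
proof -
  assume f: "f \<in> Hom C X Y"
  interpret comm_group "hom_group C X Y"
    using hom_comm_group hom_objD[OF f] by blast
  show "Neg C f \<in> Hom C X Y" "Neg C f \<oplus> f = Zero C X Y"
    using inv_closed[of f] l_inv[of f] f neg_eq_inv[OF f] by (simp_all add: hom_group_def)
qed

lemma add_closed: "\<lbrakk>f \<in> Hom C X Y; g \<in> Hom C X Y\<rbrakk> \<Longrightarrow> f \<oplus> g \<in> Hom C X Y"
  using comm_group.axioms(2)[OF hom_comm_group, THEN group.is_monoid, THEN monoid.m_closed, of X Y f g]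
    hom_objD[of f X Y] by (simp add: hom_group_def)

lemma idempotent_add_zero:
  assumes "f \<in> Hom C X Y" "f \<oplus> f = f"
  shows "f = Zero C X Y"
proof -
  interpret comm_group "hom_group C X Y"
    using hom_comm_group hom_objD[OF assms(1)] by blast
  show ?thesis
    using l_cancel_one[of f f] assms by (simp add: hom_group_def)
qed

lemma zero_add_zero:
  assumes "X \<in> Obj C" "Y \<in> Obj C"
  shows "Zero C X Y \<oplus> Zero C X Y = Zero C X Y"
proof -
  interpret comm_group "hom_group C X Y"
    using hom_comm_group assms by blast
  show ?thesis
    using l_one[of "Zero C X Y"] zero_closed[OF assms] by (simp add: hom_group_def)
qed

lemma comp_zero:
  assumes "g \<in> Hom C Y Z" "X \<in> Obj C"
  shows "g \<cdot> Zero C X Y = Zero C X Z"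
proof -
  have z: "Zero C X Y \<in> Hom C X Y"
    using assms zero_closed hom_objD by blast
  have "g \<cdot> Zero C X Y \<oplus> g \<cdot> Zero C X Y = g \<cdot> Zero C X Y"
    using comp_add_right[OF z z assms(1)] zero_add_zero[of X Y] assms hom_objD[of g Y Z] by simp
  then show ?thesis
    using idempotent_add_zero comp_closed[OF z assms(1)] by blast
qed

lemma zero_comp:
  assumes "f \<in> Hom C X Y" "Z \<in> Obj C"
  shows "Zero C Y Z \<cdot> f = Zero C X Z"
proof -
  have z: "Zero C Y Z \<in> Hom C Y Z"
    using assms zero_closed hom_objD by blast
  have "Zero C Y Z \<cdot> f \<oplus> Zero C Y Z \<cdot> f = Zero C Y Z \<cdot> f"
    using comp_add_left[OF assms(1) z z] zero_add_zero[of Y Z] assms hom_objD[of f X Y] by simp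
  then show ?thesis
    using idempotent_add_zero comp_closed[OF assms(1) z] by blast
qed

lemma neg_zero: "\<lbrakk>X \<in> Obj C; Y \<in> Obj C\<rbrakk> \<Longrightarrow> Neg C (Zero C X Y) = Zero C X Y"
  using neg_unique zero_add_zero zero_closed by blast

lemma neg_comp:
  assumes "f \<in> Hom C X Y" "g \<in> Hom C Y Z"
  shows "Neg C g \<cdot> f = Neg C (g \<cdot> f)"
proof -
  have "Neg C g \<cdot> f \<oplus> g \<cdot> f = Zero C X Z"
    using comp_add_left[OF assms(1) neg_closed[OF assms(2)] assms(2)] neg_add[OF assms(2)]
      zero_comp assms hom_objD by metis
  then show ?thesis
    using neg_unique assms comp_closed neg_closed by metis
qed

lemma comp_neg:
  assumes "f \<in> Hom C X Y" "g \<in> Hom C Y Z"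
  shows "g \<cdot> Neg C f = Neg C (g \<cdot> f)"
proof -
  have "g \<cdot> Neg C f \<oplus> g \<cdot> f = Zero C X Z"
    using comp_add_right[OF neg_closed[OF assms(1)] assms(1) assms(2)] neg_add[OF assms(1)]
      comp_zero assms hom_objD by metis
  then show ?thesis
    using neg_unique assms comp_closed neg_closed by metis
qed

lemma neg_neg:
  assumes "f \<in> Hom C X Y"
  shows "Neg C (Neg C f) = f"
proof -
  interpret comm_group "hom_group C X Y"
    using hom_comm_group hom_objD[OF assms] by blast
  show ?thesis
    using inv_inv[of f] assms neg_eq_inv[OF neg_closed[OF assms]] neg_eq_inv[OF assms]
    by (simp add: hom_group_def)
qed

lemma eq_if_difference_zero:
  assumes "f \<in> Hom C X Y" "g \<in> Hom C X Y" "f \<oplus> Neg C g = Zero C X Y"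
  shows "f = g"
  using neg_unique[OF neg_closed[OF assms(2)] assms(1,3)] neg_neg[OF assms(2)] by simp

lemma add_neg: "f \<in> Hom C X Y \<Longrightarrow> f \<oplus> Neg C f = Zero C X Y"
  using neg_add[OF neg_closed] neg_neg by metis

text \<open>
  In an additive category injectivity of composition with \<open>f\<close> need only be tested on the zero
  morphism, because the difference of two morphisms that \<open>f\<close> identifies is killed by \<open>f\<close>.
\<close>

lemma left_cancel_if_trivial_kernel:
  assumes "f \<in> Hom C Y Z" "a \<in> Hom C X Y" "b \<in> Hom C X Y" "f \<cdot> a = f \<cdot> b"
    and "\<And>w. \<lbrakk>w \<in> Hom C X Y; f \<cdot> w = Zero C X Z\<rbrakk> \<Longrightarrow> w = Zero C X Y"
  shows "a = b"
proof (rule eq_if_difference_zero[OF assms(2,3)], rule assms(5))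
  show "a \<oplus> Neg C b \<in> Hom C X Y"
    using add_closed neg_closed assms by blast
  show "f \<cdot> (a \<oplus> Neg C b) = Zero C X Z"
    using comp_add_right[OF assms(2) neg_closed[OF assms(3)] assms(1)] comp_neg[OF assms(3,1)]
      add_neg[OF comp_closed[OF assms(3,1)]] assms(4) by simp
qed

lemma right_cancel_if_trivial_kernel:
  assumes "f \<in> Hom C X Y" "a \<in> Hom C Y Z" "b \<in> Hom C Y Z" "a \<cdot> f = b \<cdot> f"
    and "\<And>w. \<lbrakk>w \<in> Hom C Y Z; w \<cdot> f = Zero C X Z\<rbrakk> \<Longrightarrow> w = Zero C Y Z"
  shows "a = b"
proof (rule eq_if_difference_zero[OF assms(2,3)], rule assms(5))
  show "a \<oplus> Neg C b \<in> Hom C Y Z"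
    using add_closed neg_closed assms by blast
  show "(a \<oplus> Neg C b) \<cdot> f = Zero C X Z"
    using comp_add_left[OF assms(1,2) neg_closed[OF assms(3)]] neg_comp[OF assms(1,3)]
      add_neg[OF comp_closed[OF assms(1,3)]] assms(4) by simp
qed

lemma hom_zeroI:
  assumes "X \<in> Obj C" "Y \<in> Obj C" "\<And>u. u \<in> Hom C X Y \<Longrightarrow> u = Zero C X Y"
  shows "Hom C X Y = {Zero C X Y}"
  using assms zero_closed by blast

lemma zero_object_iff_ident_zero:
  "zero_object C X \<longleftrightarrow> X \<in> Obj C \<and> Ident C X = Zero C X X"
proof
  assume "zero_object C X"
  then show "X \<in> Obj C \<and> Ident C X = Zero C X X"
    using ident_closed zero_closed unfolding zero_object_def by blast
next
  assume X: "X \<in> Obj C \<and> Ident C X = Zero C X X"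
  have "f = Zero C Y X" if "f \<in> Hom C Y X" for Y f
    using that X ident_comp zero_comp hom_objD by metis
  moreover have "f = Zero C X Y" if "f \<in> Hom C X Y" for Y f
    using that X comp_ident comp_zero hom_objD by metis
  ultimately show "zero_object C X"
    using X zero_closed unfolding zero_object_def by blast
qed

lemma hom_into_zero_object:
  assumes "zero_object C Z" "u \<in> Hom C X Z"
  shows "u = Zero C X Z"
  using assms ident_comp[OF assms(2)] zero_comp[OF assms(2)] zero_object_iff_ident_zero by metis

lemma hom_from_zero_object:
  assumes "zero_object C Z" "u \<in> Hom C Z X"
  shows "u = Zero C Z X"
  using assms comp_ident[OF assms(2)] comp_zero[OF assms(2)] zero_object_iff_ident_zero by metis

lemma zero_object_retract_of:
  assumes "zero_object C Z" "X \<in> Obj C"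
  shows "retract_of C Z X"
proof -
  have Z: "Z \<in> Obj C"
    using assms zero_object_iff_ident_zero by blast
  have "Zero C X Z \<cdot> Zero C Z X = Ident C Z"
    using assms Z comp_zero[OF zero_closed] zero_object_iff_ident_zero by metis
  then show ?thesis
    using Z assms zero_closed unfolding retract_of_def by blast
qed

lemma zero_object_isomorphic:
  assumes "zero_object C X" "isomorphic C X Y"
  shows "zero_object C Y"
proof -
  obtain f g where f: "f \<in> Hom C X Y" and g: "g \<in> Hom C Y X" and fg: "f \<cdot> g = Ident C Y"
    using assms(2) unfolding isomorphic_def iso_mor_def by blast
  have "f \<cdot> g = Zero C Y Y"
    using hom_from_zero_object[OF assms(1) f] zero_comp[OF g] hom_objD[OF f] by simp
  then show ?thesis
    using fg hom_objD[OF f] zero_object_iff_ident_zero by simp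
qed

definition left_orthogonal :: "'o set \<Rightarrow> 'o set" where
  "left_orthogonal E = {X \<in> Obj C. \<forall>Y \<in> E. Hom C X Y = {Zero C X Y}}"

lemma retract_closed_right_orthogonal: "retract_closed C (right_orthogonal C D)"
  unfolding retract_closed_def
proof (intro ballI impI)
  fix Y X
  assume Y: "Y \<in> right_orthogonal C D" and X: "X \<in> Obj C" and r: "retract_of C X Y"
  obtain i p where i: "i \<in> Hom C X Y" and p: "p \<in> Hom C Y X" and pi: "p \<cdot> i = Ident C X"
    using r unfolding retract_of_def by blast
  have "u = Zero C A X" if "A \<in> D" and u: "u \<in> Hom C A X" for A u
  proof -
    have "i \<cdot> u = Zero C A Y"
      using Y \<open>A \<in> D\<close> comp_closed[OF u i] unfolding right_orthogonal_def by blast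
    moreover have "p \<cdot> (i \<cdot> u) = u"
      using comp_assoc[OF u i p] pi ident_comp[OF u] by simp
    ultimately show ?thesis
      using comp_zero[OF p] hom_objD[OF u] by simp
  qed
  moreover have "A \<in> Obj C" if "A \<in> D" for A
    using Y that hom_objD(1)[of "Zero C A Y" A Y] unfolding right_orthogonal_def by blast
  ultimately show "X \<in> right_orthogonal C D"
    using X hom_zeroI unfolding right_orthogonal_def by simp
qed

lemma retract_closed_left_orthogonal: "retract_closed C (left_orthogonal E)"
  unfolding retract_closed_def
proof (intro ballI impI)
  fix Y X
  assume Y: "Y \<in> left_orthogonal E" and X: "X \<in> Obj C" and r: "retract_of C X Y"
  obtain i p where i: "i \<in> Hom C X Y" and p: "p \<in> Hom C Y X" and pi: "p \<cdot> i = Ident C X"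
    using r unfolding retract_of_def by blast
  have "u = Zero C X B" if "B \<in> E" and u: "u \<in> Hom C X B" for B u
  proof -
    have "u \<cdot> p = Zero C Y B"
      using Y \<open>B \<in> E\<close> comp_closed[OF p u] unfolding left_orthogonal_def by blast
    moreover have "u \<cdot> p \<cdot> i = u"
      using comp_assoc[OF i p u] pi comp_ident[OF u] by simp
    ultimately show ?thesis
      using zero_comp[OF i] hom_objD[OF u] by simp
  qed
  moreover have "B \<in> Obj C" if "B \<in> E" for B
    using Y that hom_objD(2)[of "Zero C Y B" Y B] unfolding left_orthogonal_def by blast
  ultimately show "X \<in> left_orthogonal E"
    using X hom_zeroI unfolding left_orthogonal_def by simp
qed

lemma zero_object_in_retract_closed:
  assumes "retract_closed C D" "D \<subseteq> Obj C" "D \<noteq> {}" "zero_object C Z"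
  shows "Z \<in> D"
  using assms zero_object_retract_of zero_object_iff_ident_zero unfolding retract_closed_def by blast

end

section \<open>The shift and distinguished triangles\<close>

context triangulated_category
begin

lemma shift_obj: "X \<in> Obj C \<Longrightarrow> ShO C X \<in> Obj C"
  using bij_betw_apply[OF shift_bij_obj] .

lemma shift_obj_inj: "\<lbrakk>X \<in> Obj C; Y \<in> Obj C; ShO C X = ShO C Y\<rbrakk> \<Longrightarrow> X = Y"
  using shift_bij_obj by (auto simp: bij_betw_def dest: inj_onD)

lemma unshift_obj:
  assumes "X \<in> Obj C"
  obtains Y where "Y \<in> Obj C" "X = ShO C Y"
  using assms bij_betw_imp_surj_on[OF shift_bij_obj] by (metis imageE)

lemma shift_hom: "f \<in> Hom C X Y \<Longrightarrow> ShM C f \<in> Hom C (ShO C X) (ShO C Y)"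
  using shift_functor by (simp add: cat_functor_def Hom_def)

lemma shift_comp: "\<lbrakk>f \<in> Hom C X Y; g \<in> Hom C Y Z\<rbrakk> \<Longrightarrow> ShM C (g \<cdot> f) = ShM C g \<cdot> ShM C f"
  using shift_functor by (simp add: cat_functor_def Hom_def)

lemma shift_ident: "X \<in> Obj C \<Longrightarrow> ShM C (Ident C X) = Ident C (ShO C X)"
  using shift_functor by (simp add: cat_functor_def)

lemma shift_faithful: "\<lbrakk>f \<in> Hom C X Y; g \<in> Hom C X' Y'; ShM C f = ShM C g\<rbrakk> \<Longrightarrow> f = g"
  using shift_bij_mor by (auto simp: Hom_def bij_betw_def dest: inj_onD)

lemma shift_full:
  assumes "g \<in> Hom C (ShO C X) (ShO C Y)" "X \<in> Obj C" "Y \<in> Obj C"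
  obtains f where "f \<in> Hom C X Y" "ShM C f = g"
proof -
  obtain f where f: "f \<in> Mor C" "ShM C f = g"
    using assms(1) bij_betw_imp_surj_on[OF shift_bij_mor] unfolding Hom_def
    by (metis (no_types, lifting) imageE mem_Collect_eq)
  have "ShM C f \<in> Hom C (ShO C (Src C f)) (ShO C (Tgt C f))"
    using shift_hom[of f "Src C f" "Tgt C f"] f unfolding Hom_def by simp
  then have "ShO C (Src C f) = ShO C X" "ShO C (Tgt C f) = ShO C Y"
    using assms(1) f unfolding Hom_def by auto
  then have "f \<in> Hom C X Y"
    using f assms shift_obj_inj src_closed tgt_closed unfolding Hom_def by blast
  then show thesis
    using that f by blast
qed

lemma shift_zero:
  assumes "X \<in> Obj C" "Y \<in> Obj C"
  shows "ShM C (Zero C X Y) = Zero C (ShO C X) (ShO C Y)"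
proof (rule idempotent_add_zero)
  have z: "Zero C X Y \<in> Hom C X Y"
    using assms zero_closed by blast
  then show "ShM C (Zero C X Y) \<in> Hom C (ShO C X) (ShO C Y)"
    by (rule shift_hom)
  show "ShM C (Zero C X Y) \<oplus> ShM C (Zero C X Y) = ShM C (Zero C X Y)"
    using hom_mult[OF shift_additive[OF assms], of "Zero C X Y" "Zero C X Y"] z
      zero_add_zero[OF assms] by (simp add: hom_group_def)
qed

lemma shift_eq_zero_iff:
  assumes "u \<in> Hom C X Y"
  shows "ShM C u = Zero C (ShO C X) (ShO C Y) \<longleftrightarrow> u = Zero C X Y"
  using shift_faithful[OF assms zero_closed[OF hom_objD[OF assms]]] shift_zero[OF hom_objD[OF assms]]
  by auto

lemma hom_zero_shift_iff:
  assumes "X \<in> Obj C" "Y \<in> Obj C"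
  shows "Hom C (ShO C X) (ShO C Y) = {Zero C (ShO C X) (ShO C Y)} \<longleftrightarrow> Hom C X Y = {Zero C X Y}"
proof
  assume L: "Hom C (ShO C X) (ShO C Y) = {Zero C (ShO C X) (ShO C Y)}"
  show "Hom C X Y = {Zero C X Y}"
  proof (rule hom_zeroI[OF assms])
    fix u assume "u \<in> Hom C X Y"
    then show "u = Zero C X Y"
      using L shift_hom shift_eq_zero_iff by blast
  qed
next
  assume R: "Hom C X Y = {Zero C X Y}"
  show "Hom C (ShO C X) (ShO C Y) = {Zero C (ShO C X) (ShO C Y)}"
  proof (rule hom_zeroI)
    fix u assume "u \<in> Hom C (ShO C X) (ShO C Y)"
    then obtain v where "v \<in> Hom C X Y" "ShM C v = u"
      using assms shift_full by blast
    then show "u = Zero C (ShO C X) (ShO C Y)"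
      using R shift_zero assms by auto
  qed (use assms shift_obj in auto)
qed

lemma zero_object_shift_iff:
  assumes "X \<in> Obj C"
  shows "zero_object C (ShO C X) \<longleftrightarrow> zero_object C X"
  unfolding zero_object_iff_ident_zero
  using shift_eq_zero_iff[OF ident_closed[OF assms]] shift_ident[OF assms] shift_obj[OF assms] assms
  by metis

text \<open>
  Naming the vertices keeps source and target computations out of the arguments below, so the
  diagram chases are stated for this predicate.
\<close>

definition distinguished :: "'o \<Rightarrow> 'o \<Rightarrow> 'o \<Rightarrow> 'm \<Rightarrow> 'm \<Rightarrow> 'm \<Rightarrow> bool" where
  "distinguished X Y Z f g h \<longleftrightarrow> (f, g, h) \<in> Dist C \<and>
     f \<in> Hom C X Y \<and> g \<in> Hom C Y Z \<and> h \<in> Hom C Z (ShO C X)"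

lemma distinguishedD:
  assumes "distinguished X Y Z f g h"
  shows "(f, g, h) \<in> Dist C" "f \<in> Hom C X Y" "g \<in> Hom C Y Z" "h \<in> Hom C Z (ShO C X)"
    "X \<in> Obj C" "Y \<in> Obj C" "Z \<in> Obj C"
proof -
  show m: "(f, g, h) \<in> Dist C" "f \<in> Hom C X Y" "g \<in> Hom C Y Z" "h \<in> Hom C Z (ShO C X)"
    using assms unfolding distinguished_def by auto
  show "X \<in> Obj C" "Y \<in> Obj C" "Z \<in> Obj C"
    using hom_objD(1)[OF m(2)] hom_objD[OF m(3)] by auto
qed

lemma dist_imp_distinguished:
  assumes "(f, g, h) \<in> Dist C"
  shows "distinguished (Src C f) (Src C g) (Src C h) f g h"
proof -
  have "(f, g, h) \<in> triangles C"
    using assms dist_triangles by blast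
  then show ?thesis
    using assms by (simp add: distinguished_def triangles_def Hom_def)
qed

lemma distinguished_rotate:
  assumes "distinguished X Y Z f g h"
  shows "distinguished Y Z (ShO C X) g h (Neg C (ShM C f))"
proof -
  note d = distinguishedD[OF assms]
  have "(f, g, h) \<in> triangles C"
    using d dist_triangles by blast
  then have "(g, h, Neg C (ShM C f)) \<in> Dist C"
    using d dist_rotate by blast
  then show ?thesis
    using d neg_closed[OF shift_hom[OF d(2)]] unfolding distinguished_def by blast
qed

lemma distinguished_ident:
  assumes "X \<in> Obj C" "zero_object C Z"
  shows "distinguished X X Z (Ident C X) (Zero C X Z) (Zero C Z (ShO C X))"
  using dist_ident[OF assms] ident_closed[OF assms(1)] zero_closed[of X Z] zero_closed[of Z "ShO C X"]
    shift_obj[OF assms(1)] assms zero_object_iff_ident_zero[of Z]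
  unfolding distinguished_def by auto

text \<open>
  The triangle \<open>Z \<rightarrow> X \<rightarrow> X \<rightarrow> Z[1]\<close> rotates to the identity triangle on \<open>X\<close> with third vertex the
  zero object \<open>Z[1]\<close>. The sign in the rotation is harmless, as it affects a zero morphism.
\<close>

lemma distinguished_ident_shifted:
  assumes "X \<in> Obj C" "zero_object C Z"
  shows "distinguished Z X X (Zero C Z X) (Ident C X) (Zero C X (ShO C Z))"
proof -
  have Z: "Z \<in> Obj C"
    using assms(2) zero_object_iff_ident_zero by blast
  have m: "Zero C Z X \<in> Hom C Z X" "Ident C X \<in> Hom C X X" "Zero C X (ShO C Z) \<in> Hom C X (ShO C Z)"
    using assms Z zero_closed ident_closed shift_obj by auto
  have "Neg C (ShM C (Zero C Z X)) = Zero C (ShO C Z) (ShO C X)"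
    using shift_zero neg_zero shift_obj Z assms by simp
  then have "(Ident C X, Zero C X (ShO C Z), Neg C (ShM C (Zero C Z X))) \<in> Dist C"
    using dist_ident[of X "ShO C Z"] assms Z zero_object_shift_iff by simp
  then show ?thesis
    using m dist_rotate[of "Zero C Z X" "Ident C X" "Zero C X (ShO C Z)"]
    unfolding distinguished_def triangles_def Hom_def by auto
qed

lemma distinguished_morphism:
  assumes "distinguished X Y Z f g h" "distinguished X' Y' Z' f' g' h'"
    and "a \<in> Hom C X X'" "b \<in> Hom C Y Y'" "b \<cdot> f = f' \<cdot> a"
  obtains c where "c \<in> Hom C Z Z'" "c \<cdot> g = g' \<cdot> b" "ShM C a \<cdot> h = h' \<cdot> c"
proof -
  note d = distinguishedD[OF assms(1)] distinguishedD[OF assms(2)]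
  have "\<exists>c. triangle_mor C (f, g, h) (f', g', h') (a, b, c)"
    using d assms by (intro dist_morphism) (auto simp: Hom_def)
  then show thesis
    using that d unfolding triangle_mor_def Hom_def by auto
qed

text \<open>
  The pair \<open>(Ident C X, f)\<close> starts a morphism of triangles from \<open>X \<rightarrow> X \<rightarrow> 0\<close> to \<open>X \<rightarrow> Y \<rightarrow> Z\<close>, so
  \<open>g \<cdot> f\<close> passes through the zero object.
\<close>

lemma distinguished_comp_zero:
  assumes "distinguished X Y Z f g h"
  shows "g \<cdot> f = Zero C X Z"
proof -
  note d = distinguishedD[OF assms]
  obtain N where N: "zero_object C N"
    using ex_zero_object by blast
  obtain c where c: "c \<in> Hom C N Z" "c \<cdot> Zero C X N = g \<cdot> f"
    using distinguished_morphism[OF distinguished_ident[OF d(5) N] assms ident_closed[OF d(5)] d(2)]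
      comp_ident d by metis
  then show ?thesis
    using comp_zero[OF c(1) d(5)] by simp
qed

lemma distinguished_comp_zero_shift:
  assumes "distinguished X Y Z f g h"
  shows "ShM C f \<cdot> h = Zero C Z (ShO C Y)"
proof -
  note d = distinguishedD[OF assms]
  have "Neg C (ShM C f \<cdot> h) = Zero C Z (ShO C Y)"
    using distinguished_comp_zero[OF distinguished_rotate[OF distinguished_rotate[OF assms]]]
      neg_comp[OF d(4) shift_hom[OF d(2)]] by simp
  then show ?thesis
    using neg_neg[OF comp_closed[OF d(4) shift_hom[OF d(2)]]] neg_zero d shift_obj by metis
qed

text \<open>
  The group-valued functors represented and corepresented by \<open>W\<close> are exact on distinguished
  triangles. Here a morphism \<open>u\<close> with \<open>u \<cdot> f = 0\<close> is the middle component of a morphism of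
  triangles to \<open>0 \<rightarrow> W \<rightarrow> W\<close>, whose third component is the factorization.
\<close>

lemma factor_through_second:
  assumes "distinguished X Y Z f g h" "u \<in> Hom C Y W" "u \<cdot> f = Zero C X W"
  obtains v where "v \<in> Hom C Z W" "u = v \<cdot> g"
proof -
  note d = distinguishedD[OF assms(1)]
  have W: "W \<in> Obj C"
    using assms(2) hom_objD by blast
  obtain N where N: "zero_object C N" "N \<in> Obj C"
    using ex_zero_object zero_object_iff_ident_zero by blast
  have "u \<cdot> f = Zero C N W \<cdot> Zero C X N"
    using assms(3) comp_zero[OF zero_closed] N W d by simp
  then obtain c where "c \<in> Hom C Z W" "c \<cdot> g = Ident C W \<cdot> u"
    using distinguished_morphism[OF assms(1) distinguished_ident_shifted[OF W N(1)]
        zero_closed[OF d(5) N(2)] assms(2)]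
    by metis
  then show thesis
    using that ident_comp[OF assms(2)] by simp
qed

text \<open>
  Dually, \<open>u\<close> is the first component of a morphism from the rotated triangle \<open>W \<rightarrow> 0 \<rightarrow> W[1]\<close> to
  \<open>Y \<rightarrow> Z \<rightarrow> X[1]\<close>. The third component is only a morphism of shifts, and it descends to \<open>W \<rightarrow> X\<close>
  because the shift is fully faithful.
\<close>

lemma factor_through_first:
  assumes "distinguished X Y Z f g h" "u \<in> Hom C W Y" "g \<cdot> u = Zero C W Z"
  obtains v where "v \<in> Hom C W X" "u = f \<cdot> v"
proof -
  note d = distinguishedD[OF assms(1)]
  have W: "W \<in> Obj C"
    using assms(2) hom_objD by blast
  obtain N where N: "zero_object C N" "N \<in> Obj C"
    using ex_zero_object zero_object_iff_ident_zero by blast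
  have "Zero C N Z \<cdot> Zero C W N = g \<cdot> u"
    using assms(3) comp_zero[OF zero_closed] N W d by simp
  then obtain c where c: "c \<in> Hom C (ShO C W) (ShO C X)"
    "ShM C u \<cdot> Neg C (ShM C (Ident C W)) = Neg C (ShM C f) \<cdot> c"
    using distinguished_morphism[OF distinguished_rotate[OF distinguished_ident[OF W N(1)]]
        distinguished_rotate[OF assms(1)] assms(2)
        zero_closed[OF N(2) d(7)]] by metis
  obtain v where v: "v \<in> Hom C W X" "ShM C v = c"
    using shift_full c(1) W d by metis
  have fv: "f \<cdot> v \<in> Hom C W Y"
    using v d comp_closed by blast
  have "Neg C (ShM C u) = ShM C u \<cdot> Neg C (ShM C (Ident C W))"
    using comp_neg[OF shift_hom[OF ident_closed[OF W]] shift_hom[OF assms(2)]] shift_ident[OF W]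
      comp_ident[OF shift_hom[OF assms(2)]] by simp
  also have "\<dots> = Neg C (ShM C (f \<cdot> v))"
    using c v neg_comp[OF c(1) shift_hom[OF d(2)]] shift_comp[OF v(1) d(2)] by simp
  finally have "ShM C u = ShM C (f \<cdot> v)"
    using neg_neg[OF shift_hom[OF assms(2)]] neg_neg[OF shift_hom[OF fv]] by metis
  then show thesis
    using that v shift_faithful assms(2) fv by blast
qed

text \<open>
  Exactness of the twice rotated triangle, with the sign of the rotation absorbed into the
  factor.
\<close>

lemma factor_through_shifted_first:
  assumes "distinguished X Y Z f g h" "u \<in> Hom C (ShO C X) W" "u \<cdot> h = Zero C Z W"
  obtains v where "v \<in> Hom C (ShO C Y) W" "u = v \<cdot> ShM C f"
proof -
  note d = distinguishedD[OF assms(1)]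
  obtain v where v: "v \<in> Hom C (ShO C Y) W" "u = v \<cdot> Neg C (ShM C f)"
    using factor_through_second[OF distinguished_rotate[OF distinguished_rotate[OF assms(1)]] assms(2,3)]
    by blast
  then have "u = Neg C v \<cdot> ShM C f"
    using comp_neg[OF shift_hom[OF d(2)] v(1)] neg_comp[OF shift_hom[OF d(2)] v(1)] by simp
  then show thesis
    using that v neg_closed by blast
qed

lemma factor_through_connecting:
  assumes "distinguished X Y Z f g h" "u \<in> Hom C W (ShO C X)" "ShM C f \<cdot> u = Zero C W (ShO C Y)"
  obtains v where "v \<in> Hom C W Z" "u = h \<cdot> v"
proof -
  note d = distinguishedD[OF assms(1)]
  have "Neg C (ShM C f) \<cdot> u = Zero C W (ShO C Y)"
    using neg_comp[OF assms(2) shift_hom[OF d(2)]] assms(3) neg_zero hom_objD[OF assms(2)] d shift_obj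
    by simp
  then show thesis
    using factor_through_first[OF distinguished_rotate[OF distinguished_rotate[OF assms(1)]] assms(2)] that
      by blast
qed

text \<open>
  Exactness makes \<open>g\<close> a split monomorphism, because \<open>f = 0\<close>, and a split epimorphism, because
  \<open>h = 0\<close>.
\<close>

lemma isomorphic_if_first_zero:
  assumes T: "distinguished X Y Z f g h" and X: "zero_object C X"
  shows "isomorphic C Y Z"
proof -
  note d = distinguishedD[OF T]
  have "Ident C Y \<cdot> f = Zero C X Y"
    using ident_comp[OF d(2)] hom_from_zero_object[OF X d(2)] by simp
  then obtain l where l: "l \<in> Hom C Z Y" "Ident C Y = l \<cdot> g"
    using factor_through_second[OF T ident_closed[OF d(6)]] by blast
  have "h \<cdot> Ident C Z = Zero C Z (ShO C X)"
    using comp_ident[OF d(4)] hom_into_zero_object[OF _ d(4)] X zero_object_shift_iff[OF d(5)] by simp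
  then obtain r where r: "r \<in> Hom C Z Y" "Ident C Z = g \<cdot> r"
    using factor_through_first[OF distinguished_rotate[OF T] ident_closed[OF d(7)]] by blast
  show ?thesis
    using isomorphic_if_mutually_inverse[OF d(3) l(1) r(1)] l r by simp
qed

text \<open>
  Here \<open>f\<close> is split epi because \<open>g = 0\<close>. The vanishing of \<open>h\<close> gives a left inverse only for
  \<open>f[1]\<close>, which the full faithfulness of the shift carries back to \<open>f\<close>.
\<close>

lemma isomorphic_if_third_zero:
  assumes T: "distinguished X Y Z f g h" and Z: "zero_object C Z"
  shows "isomorphic C X Y"
proof -
  note d = distinguishedD[OF T]
  have "g \<cdot> Ident C Y = Zero C Y Z"
    using comp_ident[OF d(3)] hom_into_zero_object[OF Z d(3)] by simp
  then obtain r where r: "r \<in> Hom C Y X" "Ident C Y = f \<cdot> r"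
    using factor_through_first[OF T ident_closed[OF d(6)]] by blast
  have "Ident C (ShO C X) \<cdot> h = Zero C Z (ShO C X)"
    using ident_comp[OF d(4)] hom_from_zero_object[OF Z d(4)] by simp
  then obtain s where s: "s \<in> Hom C (ShO C Y) (ShO C X)" "Ident C (ShO C X) = s \<cdot> ShM C f"
    using factor_through_shifted_first[OF T ident_closed[OF shift_obj[OF d(5)]]] by blast
  obtain l where l: "l \<in> Hom C Y X" "ShM C l = s"
    using shift_full s(1) d by metis
  have "ShM C (l \<cdot> f) = ShM C (Ident C X)"
    using shift_comp[OF d(2) l(1)] l s shift_ident[OF d(5)] by simp
  then have "l \<cdot> f = Ident C X"
    using shift_faithful comp_closed[OF d(2) l(1)] ident_closed[OF d(5)] by blast
  then show ?thesis
    using isomorphic_if_mutually_inverse[OF d(2) l(1) r(1)] r by simp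
qed

text \<open>
  Exactness puts \<open>Hom(A, Y)\<close> between \<open>Hom(A, X)\<close> and \<open>Hom(A, Z)\<close>. This is how the classes below
  are seen to be closed under cones.
\<close>

lemma extension_right_orthogonal:
  assumes T: "distinguished X Y Z f g h" and "A \<in> Obj C"
    and "Hom C A X = {Zero C A X}" "Hom C A Z = {Zero C A Z}"
  shows "Hom C A Y = {Zero C A Y}"
proof (rule hom_zeroI)
  note d = distinguishedD[OF T]
  show "A \<in> Obj C" "Y \<in> Obj C"
    using assms d by auto
  fix u assume u: "u \<in> Hom C A Y"
  have "g \<cdot> u = Zero C A Z"
    using comp_closed[OF u d(3)] assms by blast
  then obtain v where v: "v \<in> Hom C A X" "u = f \<cdot> v"
    using factor_through_first[OF T u] by blast
  then show "u = Zero C A Y"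
    using assms comp_zero[OF d(2)] by auto
qed

lemma extension_left_orthogonal:
  assumes T: "distinguished X Y Z f g h" and "B \<in> Obj C"
    and "Hom C X B = {Zero C X B}" "Hom C Z B = {Zero C Z B}"
  shows "Hom C Y B = {Zero C Y B}"
proof (rule hom_zeroI)
  note d = distinguishedD[OF T]
  show "B \<in> Obj C" "Y \<in> Obj C"
    using assms d by auto
  fix u assume u: "u \<in> Hom C Y B"
  have "u \<cdot> f = Zero C X B"
    using comp_closed[OF d(2) u] assms by blast
  then obtain v where v: "v \<in> Hom C Z B" "u = v \<cdot> g"
    using factor_through_second[OF T u] by blast
  then show "u = Zero C Y B"
    using assms zero_comp[OF d(3)] by auto
qed

end

section \<open>Right adjoints of full embeddings and coreflections\<close>

context category
begin

lemma full_subcat_simps: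
  "Obj (full_subcat C D) = D"
  "Mor (full_subcat C D) = {f \<in> Mor C. Src C f \<in> D \<and> Tgt C f \<in> D}"
  "Src (full_subcat C D) = Src C" "Tgt (full_subcat C D) = Tgt C"
  "Ident (full_subcat C D) = Ident C" "Comp (full_subcat C D) = Comp C"
  by (simp_all add: full_subcat_def)

lemma hom_full_subcat:
  "\<lbrakk>X \<in> D; Y \<in> D\<rbrakk> \<Longrightarrow> Hom (full_subcat C D) X Y = Hom C X Y"
  unfolding Hom_def full_subcat_simps by auto

text \<open>
  The coreflection is the counit \<open>e\<close> of the adjunction, the morphism that \<open>\<Phi>\<close> sends to the
  identity. By naturality \<open>\<Phi> (e \<cdot> u) = u\<close>, so composition with \<open>e\<close> is the inverse of the
  adjunction bijection.
\<close>

lemma coreflection_if_right_admissible: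
  assumes D: "D \<subseteq> Obj C" and adm: "right_admissible C D" and M: "M \<in> Obj C"
  shows "\<exists>A \<in> D. \<exists>e \<in> Hom C A M. \<forall>X \<in> D. bij_betw (\<lambda>u. e \<cdot> u) (Hom C X A) (Hom C X M)"
proof -
  obtain Go Gm where adj: "right_adjoint_to (full_subcat C D) C id id Go Gm"
    using adm unfolding right_admissible_def by blast
  then obtain \<Phi> where
    bij: "\<forall>X \<in> D. \<forall>Y \<in> Obj C. bij_betw (\<Phi> X Y) (Hom C X Y) (Hom (full_subcat C D) X (Go Y))"
    and nat: "\<forall>X \<in> D. \<forall>X' \<in> D. \<forall>Y \<in> Obj C. \<forall>Y' \<in> Obj C.
      \<forall>u \<in> Hom (full_subcat C D) X' X. \<forall>v \<in> Hom C Y Y'. \<forall>f \<in> Hom C X Y.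
        \<Phi> X' Y' (v \<cdot> f \<cdot> u) = Gm v \<cdot> \<Phi> X Y f \<cdot> u"
    unfolding right_adjoint_to_def full_subcat_simps id_apply by blast
  have Go: "Go Y \<in> D" if "Y \<in> Obj C" for Y
    using adj that unfolding right_adjoint_to_def cat_functor_def full_subcat_simps by blast
  have Gm: "Gm (Ident C M) = Ident C (Go M)"
    using adj M unfolding right_adjoint_to_def cat_functor_def full_subcat_simps by blast
  have bij': "bij_betw (\<Phi> X M) (Hom C X M) (Hom C X (Go M))" if "X \<in> D" for X
    using bij that M hom_full_subcat[OF that Go[OF M]] by metis
  have GM: "Go M \<in> D" "Go M \<in> Obj C"
    using Go[OF M] D by auto
  have "Ident C (Go M) \<in> \<Phi> (Go M) M ` Hom C (Go M) M"
    using bij_betw_imp_surj_on[OF bij'[OF GM(1)]] ident_closed[OF GM(2)] by simp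
  then obtain e where e: "e \<in> Hom C (Go M) M" "\<Phi> (Go M) M e = Ident C (Go M)"
    by auto
  have inv: "\<Phi> X M (e \<cdot> u) = u" if "X \<in> D" and u: "u \<in> Hom C X (Go M)" for X u
  proof -
    have "\<Phi> X M (Ident C M \<cdot> e \<cdot> u) = Gm (Ident C M) \<cdot> \<Phi> (Go M) M e \<cdot> u"
      using nat GM(1) that(1) M ident_closed[OF M] e(1) u hom_full_subcat[OF that(1) GM(1)]
      by blast
    then show ?thesis
      using Gm e ident_comp[OF e(1)] ident_comp[OF u] ident_comp[OF ident_closed[OF GM(2)]] by simp
  qed
  have "bij_betw (\<lambda>u. e \<cdot> u) (Hom C X (Go M)) (Hom C X M)" if X: "X \<in> D" for X
  proof (rule bij_betw_byWitness[where f' = "\<Phi> X M"])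
    show "\<forall>u \<in> Hom C X (Go M). \<Phi> X M (e \<cdot> u) = u"
      using inv X by blast
    show "\<forall>w \<in> Hom C X M. e \<cdot> \<Phi> X M w = w"
    proof
      fix w assume w: "w \<in> Hom C X M"
      then have w': "\<Phi> X M w \<in> Hom C X (Go M)"
        using bij_betw_apply[OF bij'[OF X]] by blast
      show "e \<cdot> \<Phi> X M w = w"
        using inj_onD[OF bij_betw_imp_inj_on[OF bij'[OF X]] inv[OF X w'] comp_closed[OF w' e(1)] w] .
    qed
    show "(\<lambda>u. e \<cdot> u) ` Hom C X (Go M) \<subseteq> Hom C X M"
      using comp_closed[OF _ e(1)] by blast
    show "\<Phi> X M ` Hom C X M \<subseteq> Hom C X (Go M)"
      using bij_betw_imp_surj_on[OF bij'[OF X]] by simp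
  qed
  then show ?thesis
    using e(1) GM(1) by blast
qed

text \<open>
  Conversely, a choice of coreflections \<open>e M : G M \<rightarrow> M\<close> determines the right adjoint: \<open>\<Phi>\<close> lifts
  along \<open>e M\<close>, and the action of \<open>G\<close> on \<open>v : M \<rightarrow> N\<close> is the lift of \<open>v \<cdot> e M\<close> along \<open>e N\<close>.
  Functoriality and naturality hold because lifts are unique.
\<close>

lemma right_admissible_if_coreflections:
  assumes D: "D \<subseteq> Obj C"
    and ex: "\<forall>M \<in> Obj C. \<exists>A \<in> D. \<exists>e \<in> Hom C A M.
      \<forall>X \<in> D. bij_betw (\<lambda>u. e \<cdot> u) (Hom C X A) (Hom C X M)"
  shows "right_admissible C D"
proof -
  have "\<exists>G. \<forall>M \<in> Obj C. G M \<in> D \<and>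
      (\<exists>e. e \<in> Hom C (G M) M \<and> (\<forall>X \<in> D. bij_betw (\<lambda>u. e \<cdot> u) (Hom C X (G M)) (Hom C X M)))"
    using ex[unfolded Bex_def] by (rule bchoice)
  then obtain G where G': "\<forall>M \<in> Obj C. G M \<in> D \<and>
      (\<exists>e. e \<in> Hom C (G M) M \<and> (\<forall>X \<in> D. bij_betw (\<lambda>u. e \<cdot> u) (Hom C X (G M)) (Hom C X M)))"
    ..
  then have "\<forall>M \<in> Obj C. \<exists>e. e \<in> Hom C (G M) M \<and>
      (\<forall>X \<in> D. bij_betw (\<lambda>u. e \<cdot> u) (Hom C X (G M)) (Hom C X M))"
    by blast
  then have "\<exists>e. \<forall>M \<in> Obj C. e M \<in> Hom C (G M) M \<and>
      (\<forall>X \<in> D. bij_betw (\<lambda>u. e M \<cdot> u) (Hom C X (G M)) (Hom C X M))"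
    by (rule bchoice)
  then obtain e where e': "\<forall>M \<in> Obj C. e M \<in> Hom C (G M) M \<and>
      (\<forall>X \<in> D. bij_betw (\<lambda>u. e M \<cdot> u) (Hom C X (G M)) (Hom C X M))"
    ..
  have G: "G M \<in> D" "G M \<in> Obj C" if "M \<in> Obj C" for M
    using G' that D by auto
  have e: "e M \<in> Hom C (G M) M" if "M \<in> Obj C" for M
    using e' that by blast
  have bij: "bij_betw (\<lambda>u. e M \<cdot> u) (Hom C X (G M)) (Hom C X M)" if "M \<in> Obj C" "X \<in> D" for M X
    using e' that by blast
  have eq: "u = u'"
    if "M \<in> Obj C" "X \<in> D" "u \<in> Hom C X (G M)" "u' \<in> Hom C X (G M)" "e M \<cdot> u = e M \<cdot> u'" for M X u u'
    using inj_onD[OF bij_betw_imp_inj_on[OF bij[OF that(1,2)]] that(5,3,4)] .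
  define \<Phi> where "\<Phi> X M = inv_into (Hom C X (G M)) (\<lambda>u. e M \<cdot> u)" for X M
  have bij_\<Phi>: "bij_betw (\<Phi> X M) (Hom C X M) (Hom C X (G M))" if "M \<in> Obj C" "X \<in> D" for M X
    using bij_betw_inv_into[OF bij[OF that]] unfolding \<Phi>_def .
  have \<Phi>: "\<Phi> X M w \<in> Hom C X (G M)" "e M \<cdot> \<Phi> X M w = w"
    if "M \<in> Obj C" "X \<in> D" "w \<in> Hom C X M" for M X w
    using bij_betw_apply[OF bij_\<Phi>[OF that(1,2)] that(3)]
      bij_betw_inv_into_right[OF bij[OF that(1,2)] that(3)] unfolding \<Phi>_def by auto
  define Gm where "Gm v = \<Phi> (G (Src C v)) (Tgt C v) (v \<cdot> e (Src C v))" for v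
  have Gm: "Gm v \<in> Hom C (G M) (G N)" "e N \<cdot> Gm v = v \<cdot> e M" if v: "v \<in> Hom C M N" for v M N
  proof -
    note o = hom_objD[OF v]
    have "Gm v = \<Phi> (G M) N (v \<cdot> e M)"
      using v unfolding Gm_def Hom_def by simp
    then show "Gm v \<in> Hom C (G M) (G N)" "e N \<cdot> Gm v = v \<cdot> e M"
      using \<Phi>[OF o(2) G(1)[OF o(1)] comp_closed[OF e[OF o(1)] v]] by auto
  qed
  have Gm_ident: "Gm (Ident C M) = Ident C (G M)" if M: "M \<in> Obj C" for M
    using eq[OF M G(1)[OF M] Gm(1)[OF ident_closed[OF M]] ident_closed[OF G(2)[OF M]]]
      Gm(2)[OF ident_closed[OF M]] ident_comp[OF e[OF M]] comp_ident[OF e[OF M]] by simp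
  have e_Gm: "e N \<cdot> (Gm v \<cdot> u) = v \<cdot> (e M \<cdot> u)"
    if v: "v \<in> Hom C M N" and u: "u \<in> Hom C X (G M)" for v u X M N
    using comp_assoc[OF u Gm(1)[OF v] e[OF hom_objD(2)[OF v]]] Gm(2)[OF v]
      comp_assoc[OF u e[OF hom_objD(1)[OF v]] v] by simp
  have Gm_comp: "Gm (g \<cdot> f) = Gm g \<cdot> Gm f" if f: "f \<in> Hom C L M" and g: "g \<in> Hom C M N" for f g L M N
  proof -
    note L = hom_objD(1)[OF f] and N = hom_objD(2)[OF g]
    have "e N \<cdot> (Gm g \<cdot> Gm f) = g \<cdot> (f \<cdot> e L)"
      using e_Gm[OF g Gm(1)[OF f]] Gm(2)[OF f] by simp
    also have "\<dots> = e N \<cdot> Gm (g \<cdot> f)"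
      using Gm(2)[OF comp_closed[OF f g]] comp_assoc[OF e[OF L] f g] by simp
    finally show ?thesis
      using eq[OF N G(1)[OF L] Gm(1)[OF comp_closed[OF f g]] comp_closed[OF Gm(1)[OF f] Gm(1)[OF g]]]
      by simp
  qed
  have "cat_functor (full_subcat C D) C id id"
    using D by (auto simp: cat_functor_def full_subcat_simps Hom_def)
  moreover have "cat_functor C (full_subcat C D) G Gm"
    unfolding cat_functor_def
  proof (intro conjI ballI impI)
    fix M assume M: "M \<in> Obj C"
    show "G M \<in> Obj (full_subcat C D)" "Gm (Ident C M) = Ident (full_subcat C D) (G M)"
      using G[OF M] Gm_ident[OF M] by (simp_all add: full_subcat_simps)
  next
    fix f assume f: "f \<in> Mor C"
    show "Gm f \<in> Hom (full_subcat C D) (G (Src C f)) (G (Tgt C f))"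
      using Gm(1)[of f "Src C f" "Tgt C f"] f G src_closed tgt_closed hom_full_subcat
      by (simp add: Hom_def[of C])
    fix g assume g: "g \<in> Mor C" "Src C g = Tgt C f"
    show "Gm (g \<cdot> f) = Gm g \<cdot>\<^bsub>full_subcat C D\<^esub> Gm f"
      using Gm_comp[of f "Src C f" "Tgt C f" g "Tgt C g"] f g by (simp add: full_subcat_simps Hom_def)
  qed
  moreover have "\<Phi> X' Y' (v \<cdot> f \<cdot> u) = Gm v \<cdot> \<Phi> X Y f \<cdot> u"
    if X: "X \<in> D" and X': "X' \<in> D" and u: "u \<in> Hom C X' X" and v: "v \<in> Hom C Y Y'" and f: "f \<in> Hom C X Y"
    for X X' Y Y' u v f
  proof -
    note Y = hom_objD(1)[OF v] and Y' = hom_objD(2)[OF v]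
    note p = \<Phi>[OF Y X f]
    have "Gm v \<cdot> \<Phi> X Y f \<cdot> u = Gm v \<cdot> (\<Phi> X Y f \<cdot> u)"
      using comp_assoc[OF u p(1) Gm(1)[OF v]] .
    moreover have "e Y' \<cdot> (Gm v \<cdot> (\<Phi> X Y f \<cdot> u)) = v \<cdot> f \<cdot> u"
      using e_Gm[OF v comp_closed[OF u p(1)]] comp_assoc[OF u p(1) e[OF Y]] p(2) comp_assoc[OF u f v]
      by simp
    moreover have w: "v \<cdot> f \<cdot> u \<in> Hom C X' Y'"
      using comp_closed[OF u comp_closed[OF f v]] .
    ultimately show ?thesis
      using eq[OF Y' X' \<Phi>(1)[OF Y' X' w] comp_closed[OF comp_closed[OF u p(1)] Gm(1)[OF v]]]
        \<Phi>(2)[OF Y' X' w] by simp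
  qed
  moreover have "bij_betw (\<Phi> X M) (Hom C X M) (Hom (full_subcat C D) X (G M))"
    if "M \<in> Obj C" "X \<in> D" for M X
    using bij_\<Phi>[OF that] hom_full_subcat[OF that(2) G(1)[OF that(1)]] by simp
  ultimately have "right_adjoint_to (full_subcat C D) C id id G Gm"
    unfolding right_adjoint_to_def full_subcat_simps id_apply
    by (intro conjI exI[of _ \<Phi>] ballI) (simp_all add: hom_full_subcat)
  then show ?thesis
    unfolding right_admissible_def by blast
qed

end

section \<open>The category of triangles\<close>

context triangulated_category
begin

lemma hom_triangle_cat:
  "\<phi> \<in> Hom (triangle_cat C) T T' \<longleftrightarrow> T \<in> triangles C \<and> T' \<in> triangles C \<and>
     (\<exists>a b c. \<phi> = (T, (a, b, c), T') \<and> triangle_mor C T T' (a, b, c))"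
  by (cases \<phi>) (auto simp: Hom_def triangle_cat_def)

lemma triangle_mor_comp:
  assumes T: "(f, g, h) \<in> triangles C" "(f', g', h') \<in> triangles C" "(f'', g'', h'') \<in> triangles C"
    and m: "triangle_mor C (f, g, h) (f', g', h') (a, b, c)"
      "triangle_mor C (f', g', h') (f'', g'', h'') (a', b', c')"
  shows "triangle_mor C (f, g, h) (f'', g'', h'') (a' \<cdot> a, b' \<cdot> b, c' \<cdot> c)"
proof -
  \<comment> \<open>Pasting of two commutative squares, used for each of the three squares of a triangle.\<close>
  have square: "y' \<cdot> y \<cdot> k = k'' \<cdot> (x' \<cdot> x)"
    if "k \<in> Hom C X Y" "k' \<in> Hom C X' Y'" "k'' \<in> Hom C X'' Y''"
      "x \<in> Hom C X X'" "x' \<in> Hom C X' X''" "y \<in> Hom C Y Y'" "y' \<in> Hom C Y' Y''"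
      "y \<cdot> k = k' \<cdot> x" "y' \<cdot> k' = k'' \<cdot> x'"
    for k k' k'' x x' y y' X X' X'' Y Y' Y''
    using that comp_assoc[OF that(1,6,7)] comp_assoc[OF that(4,2,7)] comp_assoc[OF that(4,5,3)]
    by simp
  have F: "f \<in> Hom C (Src C f) (Src C g)" "f' \<in> Hom C (Src C f') (Src C g')"
    "f'' \<in> Hom C (Src C f'') (Src C g'')"
    and Gh: "g \<in> Hom C (Src C g) (Src C h)" "g' \<in> Hom C (Src C g') (Src C h')"
    "g'' \<in> Hom C (Src C g'') (Src C h'')"
    and Hh: "h \<in> Hom C (Src C h) (ShO C (Src C f))" "h' \<in> Hom C (Src C h') (ShO C (Src C f'))"
    "h'' \<in> Hom C (Src C h'') (ShO C (Src C f''))"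
    using T unfolding triangles_def Hom_def by auto
  have a: "a \<in> Hom C (Src C f) (Src C f')" "a' \<in> Hom C (Src C f') (Src C f'')"
    and b: "b \<in> Hom C (Src C g) (Src C g')" "b' \<in> Hom C (Src C g') (Src C g'')"
    and c: "c \<in> Hom C (Src C h) (Src C h')" "c' \<in> Hom C (Src C h') (Src C h'')"
    and e: "b \<cdot> f = f' \<cdot> a" "b' \<cdot> f' = f'' \<cdot> a'" "c \<cdot> g = g' \<cdot> b" "c' \<cdot> g' = g'' \<cdot> b'"
      "ShM C a \<cdot> h = h' \<cdot> c" "ShM C a' \<cdot> h' = h'' \<cdot> c'"
    using m unfolding triangle_mor_def by auto
  have "b' \<cdot> b \<cdot> f = f'' \<cdot> (a' \<cdot> a)"
    using square[OF F a b e(1,2)] .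
  moreover have "c' \<cdot> c \<cdot> g = g'' \<cdot> (b' \<cdot> b)"
    using square[OF Gh b c e(3,4)] .
  moreover have "ShM C (a' \<cdot> a) \<cdot> h = h'' \<cdot> (c' \<cdot> c)"
    using square[OF Hh c shift_hom[OF a(1)] shift_hom[OF a(2)] e(5,6)] shift_comp[OF a] by simp
  ultimately show ?thesis
    using comp_closed[OF a] comp_closed[OF b] comp_closed[OF c] unfolding triangle_mor_def by simp
qed

lemma triangle_mor_ident:
  assumes T: "T \<in> triangles C"
  shows "triangle_mor C T T (Ident C (fst_vertex C T), Ident C (mid_vertex C T), Ident C (trd_vertex C T))"
proof -
  obtain f g h where fgh: "T = (f, g, h)"
    by (cases T)
  have F: "f \<in> Hom C (Src C f) (Src C g)" and Gh: "g \<in> Hom C (Src C g) (Src C h)"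
    and Hh: "h \<in> Hom C (Src C h) (ShO C (Src C f))"
    using T unfolding fgh triangles_def Hom_def by auto
  have o: "Src C f \<in> Obj C" "Src C g \<in> Obj C" "Src C h \<in> Obj C"
    using hom_objD[OF F] hom_objD[OF Gh] by auto
  show ?thesis
    unfolding fgh triangle_mor_def
    using o F Gh Hh ident_closed shift_ident comp_ident ident_comp by simp
qed

lemma triangle_cat_comp_closed:
  assumes "\<phi> \<in> Hom (triangle_cat C) T T'" "\<psi> \<in> Hom (triangle_cat C) T' T''"
  shows "\<psi> \<cdot>\<^bsub>triangle_cat C\<^esub> \<phi> \<in> Hom (triangle_cat C) T T''"
    "mid_component (\<psi> \<cdot>\<^bsub>triangle_cat C\<^esub> \<phi>) = mid_component \<psi> \<cdot> mid_component \<phi>"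
proof -
  obtain f g h f' g' h' f'' g'' h'' where t: "T = (f, g, h)" "T' = (f', g', h')" "T'' = (f'', g'', h'')"
    by (cases T, cases T', cases T'')
  show "\<psi> \<cdot>\<^bsub>triangle_cat C\<^esub> \<phi> \<in> Hom (triangle_cat C) T T''"
    "mid_component (\<psi> \<cdot>\<^bsub>triangle_cat C\<^esub> \<phi>) = mid_component \<psi> \<cdot> mid_component \<phi>"
    using assms triangle_mor_comp unfolding hom_triangle_cat t by (auto simp: triangle_cat_def)
qed

lemma triangle_cat_ident_closed:
  assumes "T \<in> triangles C"
  shows "Ident (triangle_cat C) T \<in> Hom (triangle_cat C) T T"
    "mid_component (Ident (triangle_cat C) T) = Ident C (mid_vertex C T)"
proof -
  have i: "Ident (triangle_cat C) T =
      (T, (Ident C (fst_vertex C T), Ident C (mid_vertex C T), Ident C (trd_vertex C T)), T)"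
    by (simp add: triangle_cat_def)
  show "Ident (triangle_cat C) T \<in> Hom (triangle_cat C) T T"
    "mid_component (Ident (triangle_cat C) T) = Ident C (mid_vertex C T)"
    using triangle_mor_ident[OF assms] assms unfolding i hom_triangle_cat by auto
qed

lemma isomorphic_fst_vertex:
  assumes "iso_mor (triangle_cat C) T T' \<phi>"
  shows "isomorphic C (fst_vertex C T) (fst_vertex C T')"
proof -
  obtain f g h f' g' h' where t: "T = (f, g, h)" "T' = (f', g', h')"
    by (cases T, cases T')
  obtain \<psi> where p: "\<phi> \<in> Hom (triangle_cat C) T T'" "\<psi> \<in> Hom (triangle_cat C) T' T"
    "\<psi> \<cdot>\<^bsub>triangle_cat C\<^esub> \<phi> = Ident (triangle_cat C) T"
    "\<phi> \<cdot>\<^bsub>triangle_cat C\<^esub> \<psi> = Ident (triangle_cat C) T'"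
    using assms unfolding iso_mor_def by blast
  obtain a b c where m: "\<phi> = (T, (a, b, c), T')" "triangle_mor C T T' (a, b, c)"
    using p(1) unfolding hom_triangle_cat by blast
  obtain a' b' c' where m': "\<psi> = (T', (a', b', c'), T)" "triangle_mor C T' T (a', b', c')"
    using p(2) unfolding hom_triangle_cat by blast
  have "a \<in> Hom C (Src C f) (Src C f')" "a' \<in> Hom C (Src C f') (Src C f)"
    using m(2) m'(2) unfolding t triangle_mor_def by auto
  moreover have "a' \<cdot> a = Ident C (Src C f)" "a \<cdot> a' = Ident C (Src C f')"
    using p(3,4) unfolding m m' t by (auto simp: triangle_cat_def)
  ultimately show ?thesis
    unfolding isomorphic_def iso_mor_def t by auto
qed

end

section \<open>Decompositions with a shift-stable first class\<close>

context triangulated_category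
begin

lemma distinguished_cone:
  assumes "f \<in> Hom C X Y"
  obtains g h where "distinguished X Y (Tgt C g) f g h"
proof -
  have "f \<in> Mor C" and ends: "Src C f = X" "Tgt C f = Y"
    using assms unfolding Hom_def by auto
  then obtain g h where gh: "(f, g, h) \<in> Dist C"
    using dist_cone by blast
  have "(f, g, h) \<in> triangles C"
    using gh dist_triangles by blast
  then have "Src C g = Y" "Src C h = Tgt C g"
    using ends unfolding triangles_def by auto
  then show thesis
    using that dist_imp_distinguished[OF gh] ends by simp
qed

lemma starI:
  assumes "distinguished A M B f g h" "A \<in> D" "B \<in> E"
  shows "M \<in> star C D E"
proof -
  note d = distinguishedD[OF assms(1)]
  have "fst_vertex C (f, g, h) = A" "mid_vertex C (f, g, h) = M" "trd_vertex C (f, g, h) = B"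
    using d unfolding Hom_def by auto
  then show ?thesis
    using d(1) assms(2,3) unfolding star_def by blast
qed

lemma starE:
  assumes "M \<in> star C D E"
  obtains A B f g h where "distinguished A M B f g h" "A \<in> D" "B \<in> E"
proof -
  obtain T where T: "T \<in> Dist C" "fst_vertex C T \<in> D" "mid_vertex C T = M" "trd_vertex C T \<in> E"
    using assms unfolding star_def by blast
  obtain f g h where fgh: "T = (f, g, h)"
    by (cases T)
  show thesis
    using that[of "Src C f" "Src C h" f g h] dist_imp_distinguished[of f g h] T unfolding fgh by auto
qed

lemma star_subset_Obj: "star C D E \<subseteq> Obj C"
proof
  fix M assume "M \<in> star C D E"
  then obtain A B f g h where "distinguished A M B f g h"
    by (rule starE)
  then show "M \<in> Obj C"
    by (rule distinguishedD(6))
qed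

lemma weight_decomposition_iff:
  "weight_decomposition C D E M (f, g, h) \<longleftrightarrow>
     (\<exists>A B. distinguished A M B f g h \<and> A \<in> D \<and> B \<in> shift_class C E)"
proof
  assume "weight_decomposition C D E M (f, g, h)"
  then show "\<exists>A B. distinguished A M B f g h \<and> A \<in> D \<and> B \<in> shift_class C E"
    using dist_imp_distinguished[of f g h] unfolding weight_decomposition_def by auto
next
  assume "\<exists>A B. distinguished A M B f g h \<and> A \<in> D \<and> B \<in> shift_class C E"
  then show "weight_decomposition C D E M (f, g, h)"
    unfolding weight_decomposition_def distinguished_def Hom_def by auto
qed

lemma star_iff_weight_decomposition:
  "M \<in> star C D (shift_class C E) \<longleftrightarrow> (\<exists>T. weight_decomposition C D E M T)"
  unfolding star_def weight_decomposition_def by blast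

lemma shift_class_memI: "X \<in> D \<Longrightarrow> ShO C X \<in> shift_class C D"
  unfolding shift_class_def by blast

lemma shift_class_memD:
  assumes "ShO C X \<in> shift_class C D" "X \<in> Obj C" "D \<subseteq> Obj C"
  shows "X \<in> D"
proof -
  obtain Y where "Y \<in> D" "ShO C X = ShO C Y"
    using assms(1) unfolding shift_class_def by blast
  then show ?thesis
    using shift_obj_inj[of X Y] assms(2,3) by auto
qed

end

text \<open>
  The common ground on which the eight conditions meet. It is enough to recover a
  semi-orthogonal decomposition, since shift stability of \<open>C2\<close> and closure of both classes under
  cones are consequences.
\<close>

locale stable_decomposition = triangulated_category C for C :: "('o, 'm, 'z) tricat_scheme" (structure) +
  fixes C1 C2 :: "'o set"
  assumes subset_Obj: "C1 \<subseteq> Obj C" "C2 \<subseteq> Obj C"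
    and iso_closed: "iso_closed C C1" "iso_closed C C2"
    and shift_stable: "shift_class C C1 = C1"
    and orth: "orthogonal C C1 C2"
    and decompose: "Obj C \<subseteq> star C C1 C2"
begin

lemma hom_zero: "\<lbrakk>A \<in> C1; B \<in> C2\<rbrakk> \<Longrightarrow> Hom C A B = {Zero C A B}"
  using orth unfolding orthogonal_def by blast

lemma shift_C1: "A \<in> C1 \<Longrightarrow> ShO C A \<in> C1"
  using shift_stable shift_class_memI by blast

lemma unshift_C1:
  assumes "A \<in> C1"
  obtains A' where "A' \<in> C1" "A = ShO C A'"
  using assms shift_stable unfolding shift_class_def by blast

text \<open>
  For \<open>M\<close> right orthogonal to \<open>C1\<close> the decomposition starts with a zero morphism \<open>A \<rightarrow> M\<close>, so
  \<open>B \<cong> M \<oplus> A[1]\<close>. As \<open>A[1]\<close> is in \<open>C1\<close>, it has no nonzero morphism to \<open>B\<close>, and therefore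
  vanishes.
\<close>

lemma C2_eq_right_orthogonal: "C2 = right_orthogonal C C1"
proof
  show "C2 \<subseteq> right_orthogonal C C1"
    using subset_Obj hom_zero unfolding right_orthogonal_def by auto
  show "right_orthogonal C C1 \<subseteq> C2"
  proof
    fix M assume "M \<in> right_orthogonal C C1"
    then have M: "M \<in> Obj C" and zero: "\<And>A. A \<in> C1 \<Longrightarrow> Hom C A M = {Zero C A M}"
      unfolding right_orthogonal_def by auto
    obtain A B f g h where T: "distinguished A M B f g h" and A: "A \<in> C1" and B: "B \<in> C2"
      using M decompose starE by (metis subsetD)
    note d = distinguishedD[OF T]
    have sA: "ShO C A \<in> Obj C"
      using shift_obj[OF d(5)] .
    have "f = Zero C A M"
      using zero[OF A] d(2) by auto
    then have "ShM C f \<cdot> Ident C (ShO C A) = Zero C (ShO C A) (ShO C M)"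
      using comp_ident[OF shift_hom[OF d(2)]] shift_zero[OF d(5) M] by simp
    then obtain s where s: "s \<in> Hom C (ShO C A) B" "Ident C (ShO C A) = h \<cdot> s"
      using factor_through_connecting[OF T ident_closed[OF sA]] by blast
    then have "Ident C (ShO C A) = Zero C (ShO C A) (ShO C A)"
      using hom_zero[OF shift_C1[OF A] B] comp_zero[OF d(4) sA] by auto
    then have "zero_object C A"
      using sA zero_object_iff_ident_zero zero_object_shift_iff[OF d(5)] by blast
    then have "isomorphic C B M"
      using isomorphic_if_first_zero[OF T] isomorphic_sym by blast
    then show "M \<in> C2"
      using iso_closed(2) B M unfolding iso_closed_def by blast
  qed
qed

text \<open>
  Dually, for \<open>M\<close> left orthogonal to \<open>C2\<close> the morphism \<open>M \<rightarrow> B\<close> is zero, and the identity of \<open>B\<close>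
  factors through \<open>A[1]\<close>, from which there are no nonzero morphisms to \<open>B\<close>.
\<close>

lemma C1_eq_left_orthogonal: "C1 = left_orthogonal C2"
proof
  show "C1 \<subseteq> left_orthogonal C2"
    using subset_Obj hom_zero unfolding left_orthogonal_def by auto
  show "left_orthogonal C2 \<subseteq> C1"
  proof
    fix M assume "M \<in> left_orthogonal C2"
    then have M: "M \<in> Obj C" and zero: "\<And>B. B \<in> C2 \<Longrightarrow> Hom C M B = {Zero C M B}"
      unfolding left_orthogonal_def by auto
    obtain A B f g h where T: "distinguished A M B f g h" and A: "A \<in> C1" and B: "B \<in> C2"
      using M decompose starE by (metis subsetD)
    note d = distinguishedD[OF T]
    have "Ident C B \<cdot> g = Zero C M B"
      using ident_comp[OF d(3)] zero[OF B] d(3) by auto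
    then obtain r where r: "r \<in> Hom C (ShO C A) B" "Ident C B = r \<cdot> h"
      using factor_through_second[OF distinguished_rotate[OF T] ident_closed[OF d(7)]] by blast
    then have "Ident C B = Zero C B B"
      using hom_zero[OF shift_C1[OF A] B] zero_comp[OF d(4,7)] by auto
    then have "zero_object C B"
      using d(7) zero_object_iff_ident_zero by blast
    then have "isomorphic C A M"
      using isomorphic_if_third_zero[OF T] by blast
    then show "M \<in> C1"
      using iso_closed(1) A M unfolding iso_closed_def by blast
  qed
qed

lemma retract_closed: "retract_closed C C1" "retract_closed C C2"
  using retract_closed_left_orthogonal[of C2] retract_closed_right_orthogonal[of C1]
  unfolding C1_eq_left_orthogonal[symmetric] C2_eq_right_orthogonal[symmetric] .

lemma mem_C1I:
  assumes "M \<in> Obj C" "\<And>B. B \<in> C2 \<Longrightarrow> Hom C M B = {Zero C M B}"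
  shows "M \<in> C1"
  using assms by (subst C1_eq_left_orthogonal) (simp add: left_orthogonal_def)

lemma mem_C2I:
  assumes "M \<in> Obj C" "\<And>A. A \<in> C1 \<Longrightarrow> Hom C A M = {Zero C A M}"
  shows "M \<in> C2"
  using assms by (subst C2_eq_right_orthogonal) (simp add: right_orthogonal_def)

text \<open>
  An object of \<open>C1\<close> has the form \<open>A'[1]\<close> with \<open>A' \<in> C1\<close>, and
  \<open>Hom(A'[1], B[1]) \<cong> Hom(A', B) = 0\<close>. So \<open>C2\<close>, being an orthogonal, inherits shift stability
  from \<open>C1\<close>.
\<close>

lemma shift_C2: "B \<in> C2 \<Longrightarrow> ShO C B \<in> C2"
proof (rule mem_C2I)
  assume B: "B \<in> C2"
  then have Bo: "B \<in> Obj C"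
    using subset_Obj by blast
  then show "ShO C B \<in> Obj C"
    by (rule shift_obj)
  fix A assume "A \<in> C1"
  then obtain A' where A': "A' \<in> C1" "A = ShO C A'"
    by (rule unshift_C1)
  then have "A' \<in> Obj C"
    using subset_Obj by blast
  then show "Hom C A (ShO C B) = {Zero C A (ShO C B)}"
    using hom_zero_shift_iff[OF _ Bo] hom_zero[OF A'(1) B] A'(2) by blast
qed

lemma unshift_C2:
  assumes "ShO C B \<in> C2" "B \<in> Obj C"
  shows "B \<in> C2"
proof (rule mem_C2I[OF assms(2)])
  fix A assume A: "A \<in> C1"
  then have "A \<in> Obj C"
    using subset_Obj by blast
  then show "Hom C A B = {Zero C A B}"
    using hom_zero_shift_iff[OF _ assms(2)] hom_zero[OF shift_C1[OF A] assms(1)] by blast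
qed

lemma shift_stable_C2: "shift_class C C2 = C2"
proof
  show "shift_class C C2 \<subseteq> C2"
    using shift_C2 unfolding shift_class_def by blast
  show "C2 \<subseteq> shift_class C C2"
  proof
    fix B assume B: "B \<in> C2"
    then have "B \<in> Obj C"
      using subset_Obj by blast
    then obtain B' where B': "B' \<in> Obj C" "B = ShO C B'"
      by (rule unshift_obj)
    then show "B \<in> shift_class C C2"
      using unshift_C2 B shift_class_memI by blast
  qed
qed

lemma zero_object_mem:
  assumes "zero_object C Z"
  shows "Z \<in> C1" "Z \<in> C2"
proof -
  have "Z \<in> Obj C"
    using assms zero_object_iff_ident_zero by blast
  then have "Z \<in> star C C1 C2"
    using decompose by blast
  then obtain A B f g h where "distinguished A Z B f g h" "A \<in> C1" "B \<in> C2"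
    by (rule starE)
  then show "Z \<in> C1" "Z \<in> C2"
    using zero_object_in_retract_closed[OF retract_closed(1) subset_Obj(1) _ assms]
      zero_object_in_retract_closed[OF retract_closed(2) subset_Obj(2) _ assms] by auto
qed

text \<open>
  The cone of \<open>X \<rightarrow> Y\<close> is an extension of \<open>X[1]\<close> by \<open>Y\<close>, and orthogonals are closed under
  extensions.
\<close>

lemma triangulated: "triangulated_subcat C C1" "triangulated_subcat C C2"
proof -
  obtain Z where Z: "zero_object C Z"
    using ex_zero_object by blast
  have cone1: "\<exists>g h. (f, g, h) \<in> Dist C \<and> Tgt C g \<in> C1"
    if X: "X \<in> C1" and Y: "Y \<in> C1" and f: "f \<in> Hom C X Y" for X Y f
  proof -
    obtain g h where T: "distinguished X Y (Tgt C g) f g h"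
      using distinguished_cone[OF f] .
    have "Tgt C g \<in> C1"
    proof (rule mem_C1I[OF distinguishedD(7)[OF T]])
      fix B assume B: "B \<in> C2"
      show "Hom C (Tgt C g) B = {Zero C (Tgt C g) B}"
        using extension_left_orthogonal[OF distinguished_rotate[OF T] subsetD[OF subset_Obj(2) B]
            hom_zero[OF Y B] hom_zero[OF shift_C1[OF X] B]] .
    qed
    then show ?thesis
      using distinguishedD(1)[OF T] by blast
  qed
  have cone2: "\<exists>g h. (f, g, h) \<in> Dist C \<and> Tgt C g \<in> C2"
    if X: "X \<in> C2" and Y: "Y \<in> C2" and f: "f \<in> Hom C X Y" for X Y f
  proof -
    obtain g h where T: "distinguished X Y (Tgt C g) f g h"
      using distinguished_cone[OF f] .
    have "Tgt C g \<in> C2"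
    proof (rule mem_C2I[OF distinguishedD(7)[OF T]])
      fix A assume A: "A \<in> C1"
      show "Hom C A (Tgt C g) = {Zero C A (Tgt C g)}"
        using extension_right_orthogonal[OF distinguished_rotate[OF T] subsetD[OF subset_Obj(1) A]
            hom_zero[OF A Y] hom_zero[OF A shift_C2[OF X]]] .
    qed
    then show ?thesis
      using distinguishedD(1)[OF T] by blast
  qed
  show "triangulated_subcat C C1"
    unfolding triangulated_subcat_def
    using Z by (intro conjI ballI subset_Obj shift_stable cone1 bexI[OF _ zero_object_mem(1)])
  show "triangulated_subcat C C2"
    unfolding triangulated_subcat_def
    using Z by (intro conjI ballI subset_Obj shift_stable_C2 cone2 bexI[OF _ zero_object_mem(2)])
qed

lemma semiorthogonal: "semiorthogonal_decomposition C C2 C1"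
  unfolding semiorthogonal_decomposition_def
  by (intro conjI iso_closed triangulated orth subset_antisym star_subset_Obj decompose)

lemma t_structure: "t_structure C C2 C1"
  unfolding t_structure_def
proof (intro conjI ballI)
  show "C2 \<subseteq> Obj C" "C1 \<subseteq> Obj C" "iso_closed C C2" "iso_closed C C1"
    "C2 \<subseteq> shift_class C C2" "shift_class C C1 \<subseteq> C1" "orthogonal C (shift_class C C1) C2"
    by (simp_all add: subset_Obj iso_closed shift_stable shift_stable_C2 orth)
  fix M assume "M \<in> Obj C"
  then obtain T where T: "T \<in> Dist C" "fst_vertex C T \<in> C1" "mid_vertex C T = M" "trd_vertex C T \<in> C2"
    using decompose unfolding star_def by blast
  then have "trd_vertex C T \<in> unshift_class C C2"
    using shift_C2 subset_Obj(2) unfolding unshift_class_def by blast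
  then show "\<exists>T \<in> Dist C. mid_vertex C T = M \<and> fst_vertex C T \<in> C1 \<and>
      trd_vertex C T \<in> unshift_class C C2"
    using T by blast
qed

lemma weight_structure: "weight_structure C C1 C2"
proof -
  have "\<exists>T. weight_decomposition C C1 C2 M T" if "M \<in> Obj C" for M
    using subsetD[OF decompose that] star_iff_weight_decomposition[of M C1 C2]
    unfolding shift_stable_C2 by blast
  then show ?thesis
    unfolding weight_structure_def
    by (simp add: subset_Obj retract_closed shift_stable shift_stable_C2 orth)
qed

lemma heart_zero: "weight_heart C1 C2 = {Z. zero_object C Z}"
proof -
  have "zero_object C X" if X: "X \<in> C1" "X \<in> C2" for X
  proof -
    have o: "X \<in> Obj C"
      using X subset_Obj by blast
    then have "Ident C X = Zero C X X"
      using hom_zero[OF X] ident_closed[OF o] by auto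
    then show ?thesis
      using o zero_object_iff_ident_zero by blast
  qed
  then show ?thesis
    using zero_object_mem unfolding weight_heart_def by blast
qed

text \<open>
  The morphism \<open>A \<rightarrow> M\<close> is a coreflection. In the exact sequence of \<open>Hom(X, -)\<close> the neighbours
  \<open>Hom(X, B[-1]) \<cong> Hom(X[1], B)\<close> and \<open>Hom(X, B)\<close> vanish. The first is used in its shifted form,
  which avoids choosing an inverse of the shift.
\<close>

lemma hom_into_first_bij:
  assumes T: "distinguished A M B f g h" and A: "A \<in> C1" and B: "B \<in> C2" and X: "X \<in> C1"
  shows "bij_betw (\<lambda>u. f \<cdot> u) (Hom C X A) (Hom C X M)"
  unfolding bij_betw_def
proof
  note d = distinguishedD[OF T]
  have Xo: "X \<in> Obj C"
    using X subset_Obj by blast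
  have kernel: "w = Zero C X A" if w: "w \<in> Hom C X A" and fw: "f \<cdot> w = Zero C X M" for w
  proof -
    have "ShM C f \<cdot> ShM C w = Zero C (ShO C X) (ShO C M)"
      using shift_comp[OF w d(2)] fw shift_zero[OF Xo d(6)] by simp
    then obtain v where v: "v \<in> Hom C (ShO C X) B" "ShM C w = h \<cdot> v"
      using factor_through_connecting[OF T shift_hom[OF w]] by blast
    then have "ShM C w = Zero C (ShO C X) (ShO C A)"
      using hom_zero[OF shift_C1[OF X] B] comp_zero[OF d(4) shift_obj[OF Xo]] by auto
    then show ?thesis
      using shift_eq_zero_iff[OF w] by blast
  qed
  show "inj_on (\<lambda>u. f \<cdot> u) (Hom C X A)"
  proof (rule inj_onI)
    fix u u' assume "u \<in> Hom C X A" "u' \<in> Hom C X A" "f \<cdot> u = f \<cdot> u'"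
    then show "u = u'"
      using left_cancel_if_trivial_kernel[OF d(2)] kernel by blast
  qed
  show "(\<lambda>u. f \<cdot> u) ` Hom C X A = Hom C X M"
  proof
    show "(\<lambda>u. f \<cdot> u) ` Hom C X A \<subseteq> Hom C X M"
      using comp_closed[OF _ d(2)] by blast
    show "Hom C X M \<subseteq> (\<lambda>u. f \<cdot> u) ` Hom C X A"
    proof
      fix w assume w: "w \<in> Hom C X M"
      have "g \<cdot> w = Zero C X B"
        using comp_closed[OF w d(3)] hom_zero[OF X B] by blast
      then obtain v where "v \<in> Hom C X A" "w = f \<cdot> v"
        using factor_through_first[OF T w] by blast
      then show "w \<in> (\<lambda>u. f \<cdot> u) ` Hom C X A"
        by blast
    qed
  qed
qed

lemma right_admissible: "right_admissible C C1"
proof (rule right_admissible_if_coreflections[OF subset_Obj(1)], intro ballI)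
  fix M assume "M \<in> Obj C"
  then have "M \<in> star C C1 C2"
    using decompose by blast
  then obtain A B f g h where T: "distinguished A M B f g h" and A: "A \<in> C1" and B: "B \<in> C2"
    by (rule starE)
  then show "\<exists>A \<in> C1. \<exists>e \<in> Hom C A M. \<forall>X \<in> C1. bij_betw (\<lambda>u. e \<cdot> u) (Hom C X A) (Hom C X M)"
    using hom_into_first_bij[OF T A B] distinguishedD(2)[OF T] by blast
qed

text \<open>
  The first component is the lift of \<open>u \<cdot> f\<close> along the coreflection \<open>f'\<close>, and the axioms extend
  it to a morphism of triangles. The third component is unique because the difference of two
  candidates kills \<open>g\<close>, hence factors through a morphism \<open>A[1] \<rightarrow> B'\<close>, which is zero.
\<close>

lemma decomposition_morphism:
  assumes T: "weight_decomposition C C1 C2 M T" and T': "weight_decomposition C C1 C2 M' T'"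
    and u: "u \<in> Hom C M M'"
  shows "\<exists>!\<phi>. \<phi> \<in> Hom (triangle_cat C) T T' \<and> mid_component \<phi> = u"
proof -
  obtain f g h f' g' h' where t: "T = (f, g, h)" "T' = (f', g', h')"
    by (cases T, cases T')
  obtain A B where D: "distinguished A M B f g h" and A: "A \<in> C1" and B: "B \<in> C2"
    using T unfolding t weight_decomposition_iff shift_stable_C2 by blast
  obtain A' B' where D': "distinguished A' M' B' f' g' h'" and A': "A' \<in> C1" and B': "B' \<in> C2"
    using T' unfolding t weight_decomposition_iff shift_stable_C2 by blast
  note d = distinguishedD[OF D] and d' = distinguishedD[OF D']
  note bij = hom_into_first_bij[OF D' A' B' A]
  have src: "Src C f = A" "Src C g = M" "Src C h = B" "Src C f' = A'" "Src C g' = M'" "Src C h' = B'"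
    using d(2-4) d'(2-4) unfolding Hom_def by auto
  have tri: "T \<in> triangles C" "T' \<in> triangles C"
    using d(1) d'(1) dist_triangles unfolding t by auto
  have mor: "triangle_mor C T T' (a, b, c) \<longleftrightarrow> a \<in> Hom C A A' \<and> b \<in> Hom C M M' \<and> c \<in> Hom C B B' \<and>
      b \<cdot> f = f' \<cdot> a \<and> c \<cdot> g = g' \<cdot> b \<and> ShM C a \<cdot> h = h' \<cdot> c" for a b c
    unfolding t triangle_mor_def by (simp add: src)
  have "u \<cdot> f \<in> (\<lambda>u. f' \<cdot> u) ` Hom C A A'"
    using bij_betw_imp_surj_on[OF bij] comp_closed[OF d(2) u] by simp
  then obtain a where a: "a \<in> Hom C A A'" "u \<cdot> f = f' \<cdot> a"
    by auto
  obtain c where c: "c \<in> Hom C B B'" "c \<cdot> g = g' \<cdot> u" "ShM C a \<cdot> h = h' \<cdot> c"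
    using distinguished_morphism[OF D D' a(1) u a(2)] by blast
  show ?thesis
  proof (rule ex1I[of _ "(T, (a, u, c), T')"])
    show "(T, (a, u, c), T') \<in> Hom (triangle_cat C) T T' \<and> mid_component (T, (a, u, c), T') = u"
      using tri a c u mor unfolding hom_triangle_cat by simp
    fix \<psi> assume psi: "\<psi> \<in> Hom (triangle_cat C) T T' \<and> mid_component \<psi> = u"
    then obtain a' u' c' where p: "\<psi> = (T, (a', u', c'), T')" "triangle_mor C T T' (a', u', c')"
      unfolding hom_triangle_cat by blast
    have m: "a' \<in> Hom C A A'" "c' \<in> Hom C B B'" "u \<cdot> f = f' \<cdot> a'" "c' \<cdot> g = g' \<cdot> u" "u' = u"
      using p psi mor by auto
    have "a' = a"
      using inj_onD[OF bij_betw_imp_inj_on[OF bij] _ m(1) a(1)] m(3) a(2) by simp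
    moreover have "c' = c"
    proof (rule right_cancel_if_trivial_kernel[OF d(3) m(2) c(1)])
      show "c' \<cdot> g = c \<cdot> g"
        using m(4) c(2) by simp
      fix w assume w: "w \<in> Hom C B B'" "w \<cdot> g = Zero C M B'"
      obtain v where v: "v \<in> Hom C (ShO C A) B'" "w = v \<cdot> h"
        using factor_through_second[OF distinguished_rotate[OF D] w] by blast
      then show "w = Zero C B B'"
        using hom_zero[OF shift_C1[OF A] B'] zero_comp[OF d(4) d'(7)] by auto
    qed
    ultimately show "\<psi> = (T, (a, u, c), T')"
      using p(1) m(5) by simp
  qed
qed

lemma weight_decomposition_triangle:
  assumes "weight_decomposition C C1 C2 M T"
  shows "T \<in> triangles C" "mid_vertex C T = M" "M \<in> Obj C"
proof -
  obtain f g h where t: "T = (f, g, h)"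
    by (cases T)
  obtain A B where D: "distinguished A M B f g h"
    using assms unfolding t weight_decomposition_iff by blast
  show "T \<in> triangles C" "mid_vertex C T = M" "M \<in> Obj C"
    using assms dist_triangles distinguishedD(6)[OF D] unfolding weight_decomposition_def by auto
qed

text \<open>
  The unique lifts of the identity of \<open>M\<close> in the two directions are mutually inverse, since
  their composites lift the identity as well.
\<close>

lemma decomposition_unique_iso:
  assumes T: "weight_decomposition C C1 C2 M T" and T': "weight_decomposition C C1 C2 M T'"
  shows "\<exists>!\<phi>. iso_mor (triangle_cat C) T T' \<phi> \<and> mid_component \<phi> = Ident C M"
proof -
  note w = weight_decomposition_triangle[OF T] and w' = weight_decomposition_triangle[OF T']
  note i = ident_closed[OF w(3)]
  have ii: "Ident C M \<cdot> Ident C M = Ident C M"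
    using ident_comp[OF i] .
  obtain \<phi> where p: "\<phi> \<in> Hom (triangle_cat C) T T'" "mid_component \<phi> = Ident C M"
    using decomposition_morphism[OF T T' i] by blast
  obtain \<psi> where q: "\<psi> \<in> Hom (triangle_cat C) T' T" "mid_component \<psi> = Ident C M"
    using decomposition_morphism[OF T' T i] by blast
  have "\<psi> \<cdot>\<^bsub>triangle_cat C\<^esub> \<phi> = Ident (triangle_cat C) T"
    using decomposition_morphism[OF T T i] triangle_cat_comp_closed[OF p(1) q(1)]
      triangle_cat_ident_closed[OF w(1)] p(2) q(2) ii w(2) by auto
  moreover have "\<phi> \<cdot>\<^bsub>triangle_cat C\<^esub> \<psi> = Ident (triangle_cat C) T'"
    using decomposition_morphism[OF T' T' i] triangle_cat_comp_closed[OF q(1) p(1)]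
      triangle_cat_ident_closed[OF w'(1)] p(2) q(2) ii w'(2) by auto
  ultimately have "iso_mor (triangle_cat C) T T' \<phi>"
    using p(1) q(1) unfolding iso_mor_def by blast
  moreover have "\<chi> = \<phi>" if "iso_mor (triangle_cat C) T T' \<chi>" "mid_component \<chi> = Ident C M" for \<chi>
    using decomposition_morphism[OF T T' i] p that unfolding iso_mor_def by blast
  ultimately show ?thesis
    using p(2) by blast
qed

text \<open>
  Any choice of decompositions is functorial: \<open>Wm u\<close> is the unique morphism of triangles over
  \<open>u\<close>, and identities and composites are preserved because they lie over identities and
  composites.
\<close>

lemma functorially_determined: "functorially_determined_decompositions C C1 C2"
proof -
  have "\<forall>M \<in> Obj C. \<exists>T. weight_decomposition C C1 C2 M T"
    using weight_structure unfolding weight_structure_def by blast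
  then have "\<exists>Wo. \<forall>M \<in> Obj C. weight_decomposition C C1 C2 M (Wo M)"
    by (rule bchoice)
  then obtain Wo where Wo: "\<forall>M \<in> Obj C. weight_decomposition C C1 C2 M (Wo M)"
    ..
  define P where "P u \<phi> \<longleftrightarrow> \<phi> \<in> Hom (triangle_cat C) (Wo (Src C u)) (Wo (Tgt C u)) \<and> mid_component \<phi> = u"
    for u \<phi>
  define Wm where "Wm u = (THE \<phi>. P u \<phi>)" for u
  have ex1: "\<exists>!\<phi>. P u \<phi>" if "u \<in> Mor C" for u
    using decomposition_morphism[of "Src C u" "Wo (Src C u)" "Tgt C u" "Wo (Tgt C u)" u]
      Wo that src_closed tgt_closed unfolding P_def Hom_def[of C] by simp
  have PW: "P u (Wm u)" if "u \<in> Mor C" for u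
    unfolding Wm_def using theI'[OF ex1[OF that]] .
  have uniq: "Wm u = \<phi>" if "u \<in> Mor C" "P u \<phi>" for u \<phi>
    using ex1[OF that(1)] PW[OF that(1)] that(2) by blast
  have "cat_functor C (triangle_cat C) Wo Wm"
    unfolding cat_functor_def
  proof (intro conjI ballI impI)
    fix M assume M: "M \<in> Obj C"
    then have wd: "weight_decomposition C C1 C2 M (Wo M)"
      using Wo by blast
    note w = weight_decomposition_triangle[OF wd]
    show "Wo M \<in> Obj (triangle_cat C)"
      using w(1) by (simp add: triangle_cat_def)
    have "Ident C M \<in> Mor C" "Src C (Ident C M) = M" "Tgt C (Ident C M) = M"
      using ident_closed[OF M] unfolding Hom_def by auto
    then show "Wm (Ident C M) = Ident (triangle_cat C) (Wo M)"
      using uniq[of "Ident C M" "Ident (triangle_cat C) (Wo M)"] triangle_cat_ident_closed[OF w(1)] w(2)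
      unfolding P_def by simp
  next
    fix f assume f: "f \<in> Mor C"
    show "Wm f \<in> Hom (triangle_cat C) (Wo (Src C f)) (Wo (Tgt C f))"
      using PW[OF f] unfolding P_def by blast
    fix g assume g: "g \<in> Mor C" "Src C g = Tgt C f"
    have gf: "g \<cdot> f \<in> Mor C" "Src C (g \<cdot> f) = Src C f" "Tgt C (g \<cdot> f) = Tgt C g"
      using comp_closed[of f "Src C f" "Tgt C f" g "Tgt C g"] f g unfolding Hom_def by auto
    have "P (g \<cdot> f) (Wm g \<cdot>\<^bsub>triangle_cat C\<^esub> Wm f)"
      using PW[OF f] PW[OF g(1)]
        triangle_cat_comp_closed[of "Wm f" "Wo (Src C f)" "Wo (Tgt C f)" "Wm g" "Wo (Tgt C g)"]
      unfolding P_def g(2) gf(2,3) by simp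
    then show "Wm (g \<cdot> f) = Wm g \<cdot>\<^bsub>triangle_cat C\<^esub> Wm f"
      using uniq gf(1) by blast
  qed
  moreover have "mid_component (Wm u) = u" if "u \<in> Mor C" for u
    using PW[OF that] unfolding P_def by blast
  moreover have "\<exists>!\<phi>. iso_mor (triangle_cat C) T (Wo M) \<phi> \<and> mid_component \<phi> = Ident C M"
    if "M \<in> Obj C" "weight_decomposition C C1 C2 M T" for M T
    using decomposition_unique_iso that Wo by blast
  ultimately show ?thesis
    unfolding functorially_determined_decompositions_def using Wo by blast
qed

lemma determined_up_to_iso: "decompositions_determined_up_to_iso C C1 C2"
  unfolding decompositions_determined_up_to_iso_def isomorphic_def
  using decomposition_unique_iso by blast

end

section \<open>Conditions that yield a stable decomposition\<close>

context triangulated_category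
begin

lemma stable_decomposition_if_semiorthogonal:
  assumes "semiorthogonal_decomposition C C2 C1"
  shows "stable_decomposition C C1 C2"
  using assms triangulated_category_axioms
  unfolding semiorthogonal_decomposition_def triangulated_subcat_def stable_decomposition_def
    stable_decomposition_axioms_def by simp

lemma stable_decomposition_if_t_structure:
  assumes t: "t_structure C C2 C1" and shift: "shift_class C C1 = C1"
  shows "stable_decomposition C C1 C2"
proof
  show "C1 \<subseteq> Obj C" "C2 \<subseteq> Obj C" "iso_closed C C1" "iso_closed C C2" "shift_class C C1 = C1"
    "orthogonal C C1 C2"
    using t shift unfolding t_structure_def by auto
  show "Obj C \<subseteq> star C C1 C2"
  proof
    fix M assume "M \<in> Obj C"
    then obtain T where T: "T \<in> Dist C" "mid_vertex C T = M" "fst_vertex C T \<in> C1"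
      "trd_vertex C T \<in> unshift_class C C2"
      using t unfolding t_structure_def by blast
    have "trd_vertex C T \<in> Obj C" "ShO C (trd_vertex C T) \<in> shift_class C C2"
      using T(4) t unfolding unshift_class_def t_structure_def by auto
    \<comment> \<open>The third vertex lies in \<open>C2[-1]\<close>, which the inclusion \<open>C2 \<subseteq> C2[1]\<close> places in \<open>C2\<close>.\<close>
    then have "trd_vertex C T \<in> C2"
      using shift_class_memD t unfolding t_structure_def by blast
    then show "M \<in> star C C1 C2"
      using T unfolding star_def by blast
  qed
qed

text \<open>
  The axioms give \<open>C1 \<bottom> C2[1]\<close>; replacing \<open>A\<close> by \<open>A[1] \<in> C1\<close> and shifting back gives \<open>C1 \<bottom> C2\<close>.
\<close>

lemma stable_decomposition_if_weight_structure:
  assumes w: "weight_structure C C1 C2" and shift: "shift_class C C1 = C1"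
  shows "stable_decomposition C C1 C2"
proof
  show sub: "C1 \<subseteq> Obj C" "C2 \<subseteq> Obj C" and "iso_closed C C1" "iso_closed C C2" "shift_class C C1 = C1"
    using w shift retract_closed_imp_iso_closed unfolding weight_structure_def by auto
  have orth: "Hom C A (ShO C B) = {Zero C A (ShO C B)}" if "A \<in> C1" "B \<in> C2" for A B
    using w that shift_class_memI unfolding weight_structure_def orthogonal_def by blast
  show "orthogonal C C1 C2"
    unfolding orthogonal_def
  proof (intro ballI)
    fix A B assume A: "A \<in> C1" and B: "B \<in> C2"
    have "A \<in> Obj C" "B \<in> Obj C" "ShO C A \<in> C1"
      using A B sub shift shift_class_memI by auto
    then show "Hom C A B = {Zero C A B}"
      using hom_zero_shift_iff[of A B] orth[of "ShO C A" B] B by simp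
  qed
  show "Obj C \<subseteq> star C C1 C2"
    using w unfolding weight_structure_def weight_decomposition_def star_def by blast
qed

text \<open>
  For \<open>X\<close> in \<open>D\<close> and \<open>u : X \<rightarrow> B\<close>, injectivity of \<open>Hom(X[-1], A) \<rightarrow> Hom(X[-1], M)\<close> forces
  \<open>h \<cdot> u = 0\<close>. So \<open>u\<close> comes from a morphism \<open>X \<rightarrow> M\<close>, which by surjectivity of
  \<open>Hom(X, A) \<rightarrow> Hom(X, M)\<close> factors through \<open>e\<close>, and then \<open>u\<close> vanishes because \<open>g \<cdot> e = 0\<close>.
\<close>

lemma right_orthogonal_cone_of_coreflection:
  assumes D: "D \<subseteq> Obj C" "shift_class C D = D"
    and T: "distinguished A M B e g h"
    and bij: "\<forall>X \<in> D. bij_betw (\<lambda>u. e \<cdot> u) (Hom C X A) (Hom C X M)"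
  shows "B \<in> right_orthogonal C D"
proof -
  note d = distinguishedD[OF T]
  have "u = Zero C X B" if X: "X \<in> D" and u: "u \<in> Hom C X B" for X u
  proof -
    obtain Y where Y: "Y \<in> D" "X = ShO C Y"
      using X D(2) unfolding shift_class_def by blast
    have o: "X \<in> Obj C" "Y \<in> Obj C"
      using X Y D(1) by auto
    have hu: "h \<cdot> u \<in> Hom C (ShO C Y) (ShO C A)"
      using comp_closed[OF u d(4)] Y(2) by simp
    obtain w where w: "w \<in> Hom C Y A" "ShM C w = h \<cdot> u"
      using shift_full[OF hu o(2) d(5)] by blast
    have "ShM C (e \<cdot> w) = ShM C e \<cdot> h \<cdot> u"
      using shift_comp[OF w(1) d(2)] w(2) comp_assoc[OF u d(4) shift_hom[OF d(2)]] by simp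
    also have "\<dots> = Zero C (ShO C Y) (ShO C M)"
      using distinguished_comp_zero_shift[OF T] zero_comp[OF u shift_obj[OF d(6)]] Y(2) by simp
    finally have "e \<cdot> w = Zero C Y M"
      using shift_eq_zero_iff[OF comp_closed[OF w(1) d(2)]] by blast
    then have "e \<cdot> w = e \<cdot> Zero C Y A"
      using comp_zero[OF d(2) o(2)] by simp
    then have "w = Zero C Y A"
      using inj_onD[OF bij_betw_imp_inj_on[OF bij[rule_format, OF Y(1)]] _ w(1) zero_closed[OF o(2) d(5)]]
      by blast
    then have "h \<cdot> u = Zero C X (ShO C A)"
      using w(2) shift_zero[OF o(2) d(5)] Y(2) by simp
    then obtain v where v: "v \<in> Hom C X M" "u = g \<cdot> v"
      using factor_through_first[OF distinguished_rotate[OF T] u] by blast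
    have "v \<in> (\<lambda>u. e \<cdot> u) ` Hom C X A"
      using bij_betw_imp_surj_on[OF bij[rule_format, OF X]] v(1) by simp
    then obtain v' where v': "v' \<in> Hom C X A" "v = e \<cdot> v'"
      by auto
    have "u = g \<cdot> e \<cdot> v'"
      using v v' comp_assoc[OF v'(1) d(2,3)] by simp
    then show ?thesis
      using distinguished_comp_zero[OF T] zero_comp[OF v'(1) d(7)] by simp
  qed
  then show ?thesis
    using d(7) hom_zeroI D(1) unfolding right_orthogonal_def by blast
qed

lemma stable_decomposition_if_right_admissible:
  assumes iso: "iso_closed C D" and tri: "triangulated_subcat C D" and adm: "right_admissible C D"
  shows "stable_decomposition C D (right_orthogonal C D)"
proof
  show D: "D \<subseteq> Obj C" and shift: "shift_class C D = D"
    using tri unfolding triangulated_subcat_def by auto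
  show "right_orthogonal C D \<subseteq> Obj C" "orthogonal C D (right_orthogonal C D)"
    unfolding right_orthogonal_def orthogonal_def by auto
  show "iso_closed C D" "iso_closed C (right_orthogonal C D)"
    using iso retract_closed_imp_iso_closed[OF retract_closed_right_orthogonal] by auto
  show "Obj C \<subseteq> star C D (right_orthogonal C D)"
  proof
    fix M assume "M \<in> Obj C"
    then obtain A e where A: "A \<in> D" and e: "e \<in> Hom C A M"
      and bij: "\<forall>X \<in> D. bij_betw (\<lambda>u. e \<cdot> u) (Hom C X A) (Hom C X M)"
      using coreflection_if_right_admissible[OF D adm] by blast
    obtain g h where T: "distinguished A M (Tgt C g) e g h"
      using distinguished_cone[OF e] .
    show "M \<in> star C D (right_orthogonal C D)"
      using starI[OF T A right_orthogonal_cone_of_coreflection[OF D shift T bij]] .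
  qed
qed

text \<open>
  If \<open>M\<close> is left orthogonal to \<open>C2[1]\<close>, the morphism \<open>M \<rightarrow> B\<close> in its weight decomposition is
  zero, so \<open>M\<close> is a retract of \<open>A\<close>. The consequence needed below is that \<open>C1\<close> is closed under
  extensions.
\<close>

lemma weight_structure_le_eq_left_orthogonal:
  assumes w: "weight_structure C C1 C2"
  shows "C1 = left_orthogonal (shift_class C C2)"
proof
  show "C1 \<subseteq> left_orthogonal (shift_class C C2)"
    using w unfolding weight_structure_def orthogonal_def left_orthogonal_def by auto
  show "left_orthogonal (shift_class C C2) \<subseteq> C1"
  proof
    fix M assume "M \<in> left_orthogonal (shift_class C C2)"
    then have M: "M \<in> Obj C" and zero: "\<And>B. B \<in> shift_class C C2 \<Longrightarrow> Hom C M B = {Zero C M B}"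
      unfolding left_orthogonal_def by auto
    have "M \<in> star C C1 (shift_class C C2)"
      using w M star_iff_weight_decomposition unfolding weight_structure_def by blast
    then obtain A B f g h where T: "distinguished A M B f g h" and A: "A \<in> C1" and B: "B \<in> shift_class C C2"
      by (rule starE)
    note d = distinguishedD[OF T]
    have "g \<cdot> Ident C M = Zero C M B"
      using comp_ident[OF d(3)] zero[OF B] d(3) by auto
    then obtain s where "s \<in> Hom C M A" "Ident C M = f \<cdot> s"
      using factor_through_first[OF T ident_closed[OF M]] by blast
    then have "retract_of C M A"
      using M d(2) unfolding retract_of_def by metis
    then show "M \<in> C1"
      using w A M unfolding weight_structure_def retract_closed_def by blast
  qed
qed

lemma weight_structure_zero_object_mem:
  assumes w: "weight_structure C C1 C2" and Z: "zero_object C Z"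
  shows "Z \<in> C1" "Z \<in> C2"
proof -
  have "Z \<in> Obj C"
    using Z zero_object_iff_ident_zero by blast
  then obtain T where "weight_decomposition C C1 C2 Z T"
    using w unfolding weight_structure_def by blast
  then have "C1 \<noteq> {}" "C2 \<noteq> {}"
    unfolding weight_decomposition_def shift_class_def by auto
  then show "Z \<in> C1" "Z \<in> C2"
    using zero_object_in_retract_closed[OF _ _ _ Z] w unfolding weight_structure_def by auto
qed

text \<open>
  Take \<open>M \<in> C1\<close> and a weight decomposition \<open>A \<rightarrow> M[1] \<rightarrow> B'[1]\<close> with \<open>B' \<in> C2\<close>. Rotating gives a
  triangle \<open>M \<rightarrow> B' \<rightarrow> A\<close>, so \<open>B'\<close> is an extension of objects of \<open>C1\<close> and lies in the heart. If
  the heart is zero, \<open>M[1] \<cong> A\<close>.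
\<close>

lemma shift_stable_if_heart_zero:
  assumes w: "weight_structure C C1 C2" and heart: "\<And>X. \<lbrakk>X \<in> C1; X \<in> C2\<rbrakk> \<Longrightarrow> zero_object C X"
  shows "shift_class C C1 = C1"
proof
  note C1 = weight_structure_le_eq_left_orthogonal[OF w]
  have sub: "C1 \<subseteq> Obj C" "C2 \<subseteq> Obj C" and s2: "shift_class C C2 \<subseteq> C2"
    and orth: "orthogonal C C1 (shift_class C C2)"
    using w unfolding weight_structure_def by auto
  show "C1 \<subseteq> shift_class C C1"
    using w unfolding weight_structure_def by blast
  show "shift_class C C1 \<subseteq> C1"
  proof
    fix N assume "N \<in> shift_class C C1"
    then obtain M where M: "M \<in> C1" "N = ShO C M"
      unfolding shift_class_def by blast
    have Mo: "M \<in> Obj C" and No: "N \<in> Obj C"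
      using M sub shift_obj by auto
    have "N \<in> star C C1 (shift_class C C2)"
      using w No star_iff_weight_decomposition unfolding weight_structure_def by blast
    then obtain A B f g h where T: "distinguished A N B f g h" and A: "A \<in> C1" and B: "B \<in> shift_class C C2"
      by (rule starE)
    note d = distinguishedD[OF T]
    obtain B' where B': "B' \<in> C2" "B = ShO C B'"
      using B unfolding shift_class_def by blast
    then have B'o: "B' \<in> Obj C"
      using sub by blast
    \<comment> \<open>The extension argument is carried out after one shift, on the triangle \<open>M[1] \<rightarrow> B'[1] \<rightarrow> A[1]\<close>.\<close>
    have "Hom C B' Y = {Zero C B' Y}" if Y: "Y \<in> shift_class C C2" for Y
    proof -
      have Yo: "Y \<in> Obj C"
        using Y s2 sub by blast
      have "Hom C M Y = {Zero C M Y}" "Hom C A Y = {Zero C A Y}"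
        using orth M(1) A Y unfolding orthogonal_def by auto
      then have "Hom C N (ShO C Y) = {Zero C N (ShO C Y)}"
        "Hom C (ShO C A) (ShO C Y) = {Zero C (ShO C A) (ShO C Y)}"
        using hom_zero_shift_iff[OF Mo Yo] hom_zero_shift_iff[OF d(5) Yo] M(2) by auto
      then have "Hom C B (ShO C Y) = {Zero C B (ShO C Y)}"
        using extension_left_orthogonal[OF distinguished_rotate[OF T] shift_obj[OF Yo]] by blast
      then show ?thesis
        using hom_zero_shift_iff[OF B'o Yo] B'(2) by simp
    qed
    then have "B' \<in> C1"
      using B'o by (subst C1) (simp add: left_orthogonal_def)
    then have "zero_object C B"
      using heart B' zero_object_shift_iff[OF B'o] by blast
    then have "isomorphic C A N"
      using isomorphic_if_third_zero[OF T] by blast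
    moreover have "iso_closed C C1"
      using w retract_closed_imp_iso_closed unfolding weight_structure_def by blast
    ultimately show "N \<in> C1"
      using A No unfolding iso_closed_def by blast
  qed
qed

text \<open>
  An object \<open>X\<close> of the heart contributes the weight decomposition \<open>X \<rightarrow> 0 \<rightarrow> X[1]\<close> of zero, a
  rotation of the identity triangle.
\<close>

lemma weight_decomposition_of_zero:
  assumes w: "weight_structure C C1 C2" and X: "X \<in> C1" "X \<in> C2" and Z: "zero_object C Z"
  shows "\<exists>T. weight_decomposition C C1 C2 Z T \<and> fst_vertex C T = X"
proof -
  have Xo: "X \<in> Obj C"
    using w X unfolding weight_structure_def by blast
  have T: "distinguished X Z (ShO C X) (Zero C X Z) (Zero C Z (ShO C X)) (Neg C (ShM C (Ident C X)))"
    using distinguished_rotate[OF distinguished_ident[OF Xo Z]] .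
  then show ?thesis
    using X shift_class_memI[OF X(2)] weight_decomposition_iff distinguishedD(2)[OF T] unfolding Hom_def
    by (intro exI[of _ "(Zero C X Z, Zero C Z (ShO C X), Neg C (ShM C (Ident C X)))"]) auto
qed

text \<open>
  Comparing the decompositions \<open>X \<rightarrow> 0 \<rightarrow> X[1]\<close> and \<open>0 \<rightarrow> 0 \<rightarrow> 0[1]\<close> of the zero object. Isomorphic
  first vertices suffice, so that the lemma serves both notions of uniqueness of weight
  decompositions.
\<close>

lemma heart_zero_if_first_vertex_unique:
  assumes w: "weight_structure C C1 C2" and X: "X \<in> C1" "X \<in> C2"
    and unique: "\<And>Z T T'. \<lbrakk>Z \<in> Obj C; weight_decomposition C C1 C2 Z T; weight_decomposition C C1 C2 Z T'\<rbrakk>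
      \<Longrightarrow> isomorphic C (fst_vertex C T) (fst_vertex C T')"
  shows "zero_object C X"
proof -
  obtain Z where Z: "zero_object C Z" "Z \<in> Obj C"
    using ex_zero_object zero_object_iff_ident_zero by blast
  obtain T where T: "weight_decomposition C C1 C2 Z T" "fst_vertex C T = X"
    using weight_decomposition_of_zero[OF w X Z(1)] by blast
  obtain T' where T': "weight_decomposition C C1 C2 Z T'" "fst_vertex C T' = Z"
    using weight_decomposition_of_zero[OF w weight_structure_zero_object_mem[OF w Z(1)] Z(1)] by blast
  have "isomorphic C Z X"
    using unique[OF Z(2) T'(1) T(1)] T(2) T'(2) by simp
  then show ?thesis
    using zero_object_isomorphic[OF Z(1)] by blast
qed

lemma stable_decomposition_if_heart_zero:
  assumes "weight_structure C C1 C2" "\<And>X. \<lbrakk>X \<in> C1; X \<in> C2\<rbrakk> \<Longrightarrow> zero_object C X"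
  shows "stable_decomposition C C1 C2"
  using stable_decomposition_if_weight_structure[OF assms(1) shift_stable_if_heart_zero[OF assms]] .

lemma stable_decomposition_if_determined_up_to_iso:
  assumes w: "weight_structure C C1 C2" and det: "decompositions_determined_up_to_iso C C1 C2"
  shows "stable_decomposition C C1 C2"
proof (rule stable_decomposition_if_heart_zero[OF w])
  fix X assume X: "X \<in> C1" "X \<in> C2"
  show "zero_object C X"
  proof (rule heart_zero_if_first_vertex_unique[OF w X])
    fix Z T T' assume "Z \<in> Obj C" "weight_decomposition C C1 C2 Z T" "weight_decomposition C C1 C2 Z T'"
    then obtain \<phi> where "iso_mor (triangle_cat C) T T' \<phi>"
      using det unfolding decompositions_determined_up_to_iso_def isomorphic_def by blast
    then show "isomorphic C (fst_vertex C T) (fst_vertex C T')"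
      by (rule isomorphic_fst_vertex)
  qed
qed

lemma stable_decomposition_if_functorially_determined:
  assumes w: "weight_structure C C1 C2" and det: "functorially_determined_decompositions C C1 C2"
  shows "stable_decomposition C C1 C2"
proof (rule stable_decomposition_if_heart_zero[OF w])
  obtain Wo where Wo: "\<And>M T. \<lbrakk>M \<in> Obj C; weight_decomposition C C1 C2 M T\<rbrakk> \<Longrightarrow>
      \<exists>\<phi>. iso_mor (triangle_cat C) T (Wo M) \<phi>"
    using det unfolding functorially_determined_decompositions_def by blast
  fix X assume X: "X \<in> C1" "X \<in> C2"
  show "zero_object C X"
  proof (rule heart_zero_if_first_vertex_unique[OF w X])
    fix Z T T' assume Z: "Z \<in> Obj C" and T: "weight_decomposition C C1 C2 Z T"
      and T': "weight_decomposition C C1 C2 Z T'"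
    have "isomorphic C (fst_vertex C T) (fst_vertex C (Wo Z))"
      "isomorphic C (fst_vertex C (Wo Z)) (fst_vertex C T')"
      using Wo[OF Z T] Wo[OF Z T'] isomorphic_fst_vertex isomorphic_sym by blast+
    then show "isomorphic C (fst_vertex C T) (fst_vertex C T')"
      by (rule isomorphic_trans)
  qed
qed

end

section \<open>Equivalence of the conditions\<close>

theorem proposition1p2p6:
  fixes C :: "('o, 'm) tricat" and C1 C2 :: "'o set"
  assumes "triangulated_category C" and "C1 \<subseteq> Obj C" and "C2 \<subseteq> Obj C"
  shows
    "(semiorthogonal_decomposition C C2 C1 \<longleftrightarrow>
        t_structure C C2 C1 \<and> shift_class C C1 = C1) \<and>
     (semiorthogonal_decomposition C C2 C1 \<longleftrightarrow>
        iso_closed C C1 \<and> triangulated_subcat C C1 \<and> right_admissible C C1 \<and>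
        C2 = right_orthogonal C C1) \<and>
     (semiorthogonal_decomposition C C2 C1 \<longleftrightarrow>
        weight_structure C C1 C2 \<and> shift_class C C1 = C1) \<and>
     (semiorthogonal_decomposition C C2 C1 \<longleftrightarrow>
        weight_structure C C1 C2 \<and> shift_class C C1 = C1 \<and> shift_class C C2 = C2) \<and>
     (semiorthogonal_decomposition C C2 C1 \<longleftrightarrow>
        weight_structure C C1 C2 \<and> weight_heart C1 C2 = {Z. zero_object C Z}) \<and>
     (semiorthogonal_decomposition C C2 C1 \<longleftrightarrow>
        weight_structure C C1 C2 \<and> functorially_determined_decompositions C C1 C2) \<and>
     (semiorthogonal_decomposition C C2 C1 \<longleftrightarrow>
        weight_structure C C1 C2 \<and> decompositions_determined_up_to_iso C C1 C2)"
proof -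
  interpret triangulated_category C
    by fact
  have sod: "semiorthogonal_decomposition C C2 C1 \<longleftrightarrow> stable_decomposition C C1 C2"
    using stable_decomposition_if_semiorthogonal stable_decomposition.semiorthogonal by blast
  have "stable_decomposition C C1 C2 \<longleftrightarrow> t_structure C C2 C1 \<and> shift_class C C1 = C1"
    using stable_decomposition_if_t_structure stable_decomposition.t_structure
      stable_decomposition.shift_stable by blast
  moreover have "stable_decomposition C C1 C2 \<longleftrightarrow>
      iso_closed C C1 \<and> triangulated_subcat C C1 \<and> right_admissible C C1 \<and> C2 = right_orthogonal C C1"
    using stable_decomposition_if_right_admissible[of C1] stable_decomposition.iso_closed(1)
      stable_decomposition.triangulated(1) stable_decomposition.right_admissible
      stable_decomposition.C2_eq_right_orthogonal by metis
  moreover have "stable_decomposition C C1 C2 \<longleftrightarrow> weight_structure C C1 C2 \<and> shift_class C C1 = C1"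
    using stable_decomposition_if_weight_structure stable_decomposition.weight_structure
      stable_decomposition.shift_stable by blast
  moreover have "stable_decomposition C C1 C2 \<longleftrightarrow>
      weight_structure C C1 C2 \<and> shift_class C C1 = C1 \<and> shift_class C C2 = C2"
    using stable_decomposition_if_weight_structure stable_decomposition.weight_structure
      stable_decomposition.shift_stable stable_decomposition.shift_stable_C2 by blast
  moreover have "stable_decomposition C C1 C2 \<longleftrightarrow>
      weight_structure C C1 C2 \<and> weight_heart C1 C2 = {Z. zero_object C Z}"
    using stable_decomposition_if_heart_zero[of C1 C2] stable_decomposition.weight_structure[of C C1 C2]
      stable_decomposition.heart_zero[of C C1 C2] unfolding weight_heart_def by blast
  moreover have "stable_decomposition C C1 C2 \<longleftrightarrow>
      weight_structure C C1 C2 \<and> functorially_determined_decompositions C C1 C2"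
    using stable_decomposition_if_functorially_determined stable_decomposition.weight_structure
      stable_decomposition.functorially_determined by blast
  moreover have "stable_decomposition C C1 C2 \<longleftrightarrow>
      weight_structure C C1 C2 \<and> decompositions_determined_up_to_iso C C1 C2"
    using stable_decomposition_if_determined_up_to_iso stable_decomposition.weight_structure
      stable_decomposition.determined_up_to_iso by blast
  ultimately show ?thesis
    unfolding sod by blast
qed

end
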